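(* Let $d,p\ge 1$ be integers, let $0<\mu\le L$, and put $\kappa=L/\mu$. Let $\mathcal{A}$ be a $p$-SCLI optimization algorithm over $\mathbb{R}^d$ which is consistent with respect to $\mathcal{Q}^d([\mu,L])$. If the inversion matrix $N(X)$ of $\mathcal{A}$ is diagonal, then there exist a quadratic function $f_{A,\mathbf{b}}\in\mathcal{Q}^d([\mu,L])$ and initialization points $\mathcal{X}^0\in\mathbb{R}^{dp}$ such that $$\mathcal{IC}_{\mathcal{A}}\left(\epsilon,f_{A,\mathbf{b}},\mathcal{X}^0\right)=\tilde{\Omega}\left(\frac{\sqrt[p]{\kappa}-1}{2}\,\ln(1/\epsilon)\right).$$
   Context: For $\Sigma\subseteq(0,\infty)$ nonempty, $\mathcal{S}^d(\Sigma)$ is the set of real symmetric $d\times d$ matrices with all eigenvalues in $\Sigma$, and $\mathcal{Q}^d(\Sigma)$ is the set of functions $f_{A,\mathbf{b}}(\mathbf{x})=\frac12\mathbf{x}^\top A\mathbf{x}+\mathbf{b}^\top\mathbf{x}$ with $A\in\mathcal{S}^d(\Sigma)$, $\mathbf{b}\in\mathbb{R}^d$; the minimizer of $f_{A,\mathbf{b}}$ is $\mathbf{x}^*=-A^{-1}\mathbf{b}$. A $p$-SCLI optimization algorithm $\mathcal{A}$ over $\mathbb{R}^d$ is given by $p+1$ mappings $C_0(X),\dots,C_{p-1}(X)$ (coefficient matrices) and $N(X)$ (inversion matrix) from $\mathbb{R}^{d\times d}$ to $\mathbb{R}^{d\times d}$-valued random variables. Applied to $f_{A,\mathbf{b}}$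 with initialization points $\mathcal{X}^0=(\mathbf{x}^0,\dots,\mathbf{x}^{p-1})\in(\mathbb{R}^{d})^p$ it generates $$\mathbf{x}^k=\sum_{j=0}^{p-1}C_j(A)\mathbf{x}^{k-p+j}+N(A)\mathbf{b},\qquad k=p,p+1,\dots,$$ where in each iteration the tuple $(C_0(A),\dots,C_{p-1}(A),N(A))$ is drawn afresh from the same law, independently of all previous realizations. The expectations $\mathbb{E}C_j(A)$ and $\mathbb{E}N(A)$ are assumed finite, and $\mathbb{E}C_0(A),\dots,\mathbb{E}C_{p-1}(A)$ are assumed simultaneously triangularizable by a real invertible matrix. $\mathcal{A}$ is consistent with respect to $A\in\mathcal{S}^d(\Sigma)$ if for every $\mathbf{b}\in\mathbb{R}^d$ and all initialization points $\mathbb{E}\mathbf{x}^k\to-A^{-1}\mathbf{b}$; it is consistent with respect to $\mathcal{Q}^d(\Sigma)$ if it is consistent with respect to every $A\in\mathcal{S}^d(\Sigma)$. The iteration complexity $\mathcal{IC}_{\mathcal{A}}(\epsilon,f_{A,\mathbf{b}},\mathcal{X}^0)$ is the minimal $K$ such that $\|\mathbb{E}[\mathbf{x}^k-\mathbf{x}^*]\|<\epsilon$ for all $k\ge K$ (Euclidean norm), when $\mathcal{A}$ is initialized at $\mathcal{X}^0$. Asymptotic convention (as $\epsilon\to0$): $g(\epsilon)=\tilde\Omega(R\ln(1/\epsilon))$ means that there is a universal constant $c>0$ and some $\epsilon_0\in(0,1)$, which may depend on the algorithm, the quadratic function and the initialization points, such that $g(\epsilon)\ge c\,R\ln(1/\epsilon)$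 for all $\epsilon\in(0,\epsilon_0)$.
   Formalization: The case d = 1 with μ < L is excluded, because there every inversion matrix is diagonal and the algorithm with C_j(X) = 0, N(X) = −1/X is consistent and reaches the minimizer at step p, so the claimed bound fails. *)

theory Defs
  imports
    "HOL-Probability.Probability"
    "Jordan_Normal_Form.Char_Poly"
    "Jordan_Normal_Form.Gauss_Jordan_Elimination"
begin

hide_type (open) Finite_Cartesian_Product.vec
hide_const (open) Finite_Cartesian_Product.vec Finite_Cartesian_Product.row
  Finite_Cartesian_Product.mat Finite_Cartesian_Product.vec_nth Determinants.det
no_notation Finite_Cartesian_Product.vec_nth (infixl "$" 90)
no_notation Inner_Product.real_inner_class.inner (infix "\<bullet>" 70)

text \<open>Matrices and vectors with explicit dimension are used, rather than vectors indexed by a finite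
type, so that a constant can be chosen uniformly in \<open>d\<close>.\<close>

text \<open>A real symmetric matrix has only real eigenvalues, so it suffices to constrain those.
The quadratic function \<open>f x = 1/2 * (x \<bullet> (A *\<^sub>v x)) + b \<bullet> x\<close> with symmetric \<open>A\<close> determines the
pair \<open>(A, b)\<close> and is represented by it everywhere below.\<close>

definition sym_mats :: "nat \<Rightarrow> real set \<Rightarrow> real mat set" where
  "sym_mats d \<Sigma> = {A \<in> carrier_mat d d. transpose_mat A = A \<and> (\<forall>l. eigenvalue A l \<longrightarrow> l \<in> \<Sigma>)}"

definition quad_minimizer :: "real mat \<Rightarrow> real vec \<Rightarrow> real vec" where
  "quad_minimizer A b = - (the (mat_inverse A) *\<^sub>v b)"

definition euclid_norm :: "real vec \<Rightarrow> real" where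
  "euclid_norm v = sqrt (v \<bullet> v)"

text \<open>The Borel \<open>\<sigma>\<close>-algebra of the \<open>d \<times> d\<close> matrices, generated by the entries.\<close>

definition mat_borel :: "nat \<Rightarrow> real mat measure" where
  "mat_borel d = sigma (carrier_mat d d)
     {{M \<in> carrier_mat d d. M $$ (i, j) \<in> B} | i j B. i < d \<and> j < d \<and> B \<in> sets borel}"

text \<open>One draw \<open>s\<close> of an algorithm is a tuple of matrices: \<open>fst s j\<close> is the coefficient matrix
\<open>C\<^sub>j\<close> for \<open>j < p\<close>, and \<open>snd s\<close> is the inversion matrix \<open>N\<close>. An algorithm maps a matrix \<open>X\<close> to the
joint law of the tuple \<open>(C\<^sub>0(X), \<dots>, C\<^sub>p\<^sub>-\<^sub>1(X), N(X))\<close>, the entries of which may be dependent.\<close>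

type_synonym draw = "(nat \<Rightarrow> real mat) \<times> real mat"
type_synonym algorithm = "real mat \<Rightarrow> draw measure"

definition draw_space :: "nat \<Rightarrow> nat \<Rightarrow> draw measure" where
  "draw_space p d = (\<Pi>\<^sub>M j\<in>{..<p}. mat_borel d) \<Otimes>\<^sub>M mat_borel d"

definition integrable_mat :: "nat \<Rightarrow> 'a measure \<Rightarrow> ('a \<Rightarrow> real mat) \<Rightarrow> bool" where
  "integrable_mat d M Y \<longleftrightarrow> (\<forall>i<d. \<forall>j<d. integrable M (\<lambda>\<omega>. Y \<omega> $$ (i, j)))"

definition expectation_mat :: "nat \<Rightarrow> 'a measure \<Rightarrow> ('a \<Rightarrow> real mat) \<Rightarrow> real mat" where
  "expectation_mat d M Y = mat d d (\<lambda>(i, j). \<integral>\<omega>. Y \<omega> $$ (i, j) \<partial>M)"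

definition expectation_vec :: "nat \<Rightarrow> 'a measure \<Rightarrow> ('a \<Rightarrow> real vec) \<Rightarrow> real vec" where
  "expectation_vec d M Y = vec d (\<lambda>i. \<integral>\<omega>. Y \<omega> $ i \<partial>M)"

definition simultaneously_triangularizable :: "nat \<Rightarrow> real mat set \<Rightarrow> bool" where
  "simultaneously_triangularizable d \<M> \<longleftrightarrow>
     (\<exists>P \<in> carrier_mat d d. \<exists>Q \<in> carrier_mat d d. inverts_mat P Q \<and> inverts_mat Q P \<and>
        (\<forall>M \<in> \<M>. upper_triangular (Q * M * P)))"

definition scli :: "nat \<Rightarrow> nat \<Rightarrow> algorithm \<Rightarrow> bool" where
  "scli p d \<A> \<longleftrightarrow>
     (\<forall>X \<in> carrier_mat d d. prob_space (\<A> X) \<and> sets (\<A> X) = sets (draw_space p d)) \<and>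
     (\<forall>A \<in> sym_mats d {0<..}.
        (\<forall>j<p. integrable_mat d (\<A> A) (\<lambda>s. fst s j)) \<and>
        integrable_mat d (\<A> A) snd \<and>
        simultaneously_triangularizable d
          ((\<lambda>j. expectation_mat d (\<A> A) (\<lambda>s. fst s j)) ` {..<p}))"

text \<open>The iterates for a given sequence \<open>\<omega>\<close> of draws, \<open>\<omega> k\<close> being the draw used in step \<open>k\<close>.\<close>

fun iterate :: "nat \<Rightarrow> nat \<Rightarrow> real vec \<Rightarrow> (nat \<Rightarrow> real vec) \<Rightarrow> (nat \<Rightarrow> draw) \<Rightarrow> nat \<Rightarrow> real vec" where
  "iterate p d b X0 \<omega> k =
     (if k < p then X0 k
      else vec d (\<lambda>i. (\<Sum>j<p. (fst (\<omega> k) j *\<^sub>v iterate p d b X0 \<omega> (k - p + j)) $ i)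
                      + (snd (\<omega> k) *\<^sub>v b) $ i))"

declare iterate.simps [simp del]

text \<open>Independent, identically distributed draws: the expectation is taken with respect to the
infinite product of the law of one draw.\<close>

definition mean_iterate ::
    "nat \<Rightarrow> nat \<Rightarrow> algorithm \<Rightarrow> real mat \<Rightarrow> real vec \<Rightarrow> (nat \<Rightarrow> real vec) \<Rightarrow> nat \<Rightarrow> real vec" where
  "mean_iterate p d \<A> A b X0 k =
     expectation_vec d (\<Pi>\<^sub>M n\<in>UNIV. \<A> A) (\<lambda>\<omega>. iterate p d b X0 \<omega> k)"

definition init_points :: "nat \<Rightarrow> nat \<Rightarrow> (nat \<Rightarrow> real vec) set" where
  "init_points p d = {X0. \<forall>j<p. X0 j \<in> carrier_vec d}"

definition consistent_wrt :: "nat \<Rightarrow> nat \<Rightarrow> algorithm \<Rightarrow> real mat \<Rightarrow> bool" where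
  "consistent_wrt p d \<A> A \<longleftrightarrow>
     (\<forall>b \<in> carrier_vec d. \<forall>X0 \<in> init_points p d.
        (\<lambda>k. euclid_norm (mean_iterate p d \<A> A b X0 k - quad_minimizer A b)) \<longlonglongrightarrow> 0)"

definition consistent :: "nat \<Rightarrow> nat \<Rightarrow> algorithm \<Rightarrow> real set \<Rightarrow> bool" where
  "consistent p d \<A> \<Sigma> \<longleftrightarrow> (\<forall>A \<in> sym_mats d \<Sigma>. consistent_wrt p d \<A> A)"

definition diagonal_inversion :: "nat \<Rightarrow> algorithm \<Rightarrow> bool" where
  "diagonal_inversion d \<A> \<longleftrightarrow> (\<forall>X \<in> carrier_mat d d. AE s in \<A> X. diagonal_mat (snd s))"

text \<open>If the algorithm is consistent with respect to \<open>A\<close>, the minimum is over a nonempty set. Since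
\<open>x\<^sup>* = - A\<^sup>-\<^sup>1 b\<close> is deterministic, \<open>\<E>[x\<^sup>k - x\<^sup>*] = \<E> x\<^sup>k - x\<^sup>*\<close>.\<close>

definition iteration_complexity ::
    "nat \<Rightarrow> nat \<Rightarrow> algorithm \<Rightarrow> real \<Rightarrow> real mat \<Rightarrow> real vec \<Rightarrow> (nat \<Rightarrow> real vec) \<Rightarrow> nat" where
  "iteration_complexity p d \<A> \<epsilon> A b X0 =
     (LEAST K. \<forall>k\<ge>K. euclid_norm (mean_iterate p d \<A> A b X0 k - quad_minimizer A b) < \<epsilon>)"

text \<open>\<open>g(\<epsilon>) = \<Omega>(R ln(1/\<epsilon>))\<close> as \<open>\<epsilon> \<rightarrow> 0\<close>, with the implied constant \<open>c\<close> made explicit so that it can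
be quantified before everything else.\<close>

definition Omega_tilde :: "real \<Rightarrow> real \<Rightarrow> (real \<Rightarrow> real) \<Rightarrow> bool" where
  "Omega_tilde c R g \<longleftrightarrow>
     (\<exists>\<epsilon>\<^sub>0. 0 < \<epsilon>\<^sub>0 \<and> \<epsilon>\<^sub>0 < 1 \<and> (\<forall>\<epsilon>. 0 < \<epsilon> \<and> \<epsilon> < \<epsilon>\<^sub>0 \<longrightarrow> c * (R * ln (1 / \<epsilon>)) \<le> g \<epsilon>))"

lemma space_mat_borel: "space (mat_borel d) = carrier_mat d d"
  unfolding mat_borel_def by (rule space_measure_of) auto

lemma entry_measurable:
  assumes "i < d" "j < d"
  shows "(\<lambda>M. M $$ (i, j)) \<in> borel_measurable (mat_borel d)"
proof (rule measurableI)
  fix B :: "real set" assume B: "B \<in> sets borel"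
  have eq: "(\<lambda>M. M $$ (i, j)) -` B \<inter> space (mat_borel d) = {M \<in> carrier_mat d d. M $$ (i, j) \<in> B}"
    unfolding space_mat_borel by auto
  have "{M \<in> carrier_mat d d. M $$ (i, j) \<in> B} \<in> {{M \<in> carrier_mat d d. M $$ (i, j) \<in> B} | i j B. i < d \<and> j < d \<and> B \<in> sets borel}"
    by (rule CollectI, rule exI[of _ i], rule exI[of _ j], rule exI[of _ B]) (simp add: assms B)
  then have "{M \<in> carrier_mat d d. M $$ (i, j) \<in> B} \<in> sets (mat_borel d)"
    unfolding mat_borel_def by (rule in_measure_of[rotated]) auto
  then show "(\<lambda>M. M $$ (i, j)) -` B \<inter> space (mat_borel d) \<in> sets (mat_borel d)"
    unfolding eq .
qed simp

lemma coefficient_measurable: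
  assumes "sets M = sets (draw_space p d)" "j < p" "i < d" "l < d"
  shows "(\<lambda>s. fst s j $$ (i, l)) \<in> borel_measurable M"
proof -
  have "(\<lambda>s. fst s j) \<in> measurable (draw_space p d) (mat_borel d)"
    unfolding draw_space_def
    by (rule measurable_compose[OF measurable_fst measurable_component_singleton])
       (simp add: assms(2))
  from measurable_compose[OF this entry_measurable[OF assms(3,4)]]
  show ?thesis unfolding measurable_cong_sets[OF assms(1) refl] .
qed

lemma inversion_measurable:
  assumes "sets M = sets (draw_space p d)" "i < d" "l < d"
  shows "(\<lambda>s. snd s $$ (i, l)) \<in> borel_measurable M"
proof -
  have "snd \<in> measurable (draw_space p d) (mat_borel d)"
    unfolding draw_space_def by (rule measurable_snd)
  from measurable_compose[OF this entry_measurable[OF assms(2,3)]]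
  show ?thesis unfolding measurable_cong_sets[OF assms(1) refl] .
qed

lemma space_draw:
  assumes "sets M = sets (draw_space p d)" "s \<in> space M"
  shows "\<And>j. j < p \<Longrightarrow> fst s j \<in> carrier_mat d d" "snd s \<in> carrier_mat d d"
proof -
  have "fst s \<in> (\<Pi>\<^sub>E j\<in>{..<p}. carrier_mat d d) \<and> snd s \<in> carrier_mat d d"
    using assms(2)
    unfolding sets_eq_imp_space_eq[OF assms(1)] draw_space_def space_pair_measure space_PiM
      space_mat_borel mem_Times_iff .
  then show "\<And>j. j < p \<Longrightarrow> fst s j \<in> carrier_mat d d" "snd s \<in> carrier_mat d d"
    by (blast intro: PiE_mem)+
qed

lemma iterate_carrier: "X0 \<in> init_points p d \<Longrightarrow> iterate p d b X0 \<omega> k \<in> carrier_vec d"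
  by (subst iterate.simps) (auto simp: init_points_def)

lemma iterate_component:
  assumes "p \<le> k" "X0 \<in> init_points p d" "b \<in> carrier_vec d" "i < d"
    and "\<And>j. j < p \<Longrightarrow> fst (\<omega> k) j \<in> carrier_mat d d" "snd (\<omega> k) \<in> carrier_mat d d"
  shows "iterate p d b X0 \<omega> k $ i =
    (\<Sum>j<p. \<Sum>l<d. fst (\<omega> k) j $$ (i, l) * iterate p d b X0 \<omega> (k - p + j) $ l)
    + (\<Sum>l<d. snd (\<omega> k) $$ (i, l) * b $ l)"
proof -
  have *: "(M *\<^sub>v v) $ i = (\<Sum>l<d. M $$ (i, l) * v $ l)"
    if "M \<in> carrier_mat d d" "v \<in> carrier_vec d" for M :: "real mat" and v
    using that assms(4) by (auto simp: scalar_prod_def atLeast0LessThan)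
  show ?thesis
    using assms(1,4) *[OF assms(6,3)] *[OF assms(5) iterate_carrier[OF assms(2)]]
    by (subst iterate.simps) simp
qed

lemma iterate_measurable:
  assumes M: "sets M = sets (draw_space p d)" and X0: "X0 \<in> init_points p d"
    and b: "b \<in> carrier_vec d" and i: "i < d"
  shows "(\<lambda>\<omega>. iterate p d b X0 \<omega> k $ i) \<in> borel_measurable (\<Pi>\<^sub>M n\<in>UNIV. M)"
  using i
proof (induction k arbitrary: i rule: less_induct)
  case (less k)
  show ?case
  proof (cases "k < p")
    case True
    then show ?thesis by (subst iterate.simps) simp
  next
    case False
    let ?P = "\<Pi>\<^sub>M n\<in>UNIV. M"
    have comp: "(\<lambda>\<omega>. \<omega> k) \<in> measurable ?P M" by measurable
    have 1: "(\<lambda>\<omega>. fst (\<omega> k) j $$ (i, l)) \<in> borel_measurable ?P" if "j < p" "l < d" for j l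
      by (rule measurable_compose[OF comp coefficient_measurable[OF M that(1) less.prems that(2)]])
    have 2: "(\<lambda>\<omega>. snd (\<omega> k) $$ (i, l)) \<in> borel_measurable ?P" if "l < d" for l
      by (rule measurable_compose[OF comp inversion_measurable[OF M less.prems that]])
    have 3: "(\<lambda>\<omega>. iterate p d b X0 \<omega> (k - p + j) $ l) \<in> borel_measurable ?P"
      if "j < p" "l < d" for j l
      using less.IH that False by simp
    have eq: "iterate p d b X0 \<omega> k $ i =
        (\<Sum>j<p. \<Sum>l<d. fst (\<omega> k) j $$ (i, l) * iterate p d b X0 \<omega> (k - p + j) $ l)
        + (\<Sum>l<d. snd (\<omega> k) $$ (i, l) * b $ l)" if "\<omega> \<in> space ?P" for \<omega>
    proof -
      have "\<omega> k \<in> space M" using that by (auto simp: space_PiM)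
      note s = space_draw[OF M this]
      show ?thesis
        by (rule iterate_component[OF _ X0 b less.prems]) (use False s in auto)
    qed
    show ?thesis
      by (subst measurable_cong[OF eq], assumption)
         (intro borel_measurable_add borel_measurable_sum borel_measurable_times 1 2 3
           borel_measurable_const; simp)+
  qed
qed

text \<open>In dimension one the hypothesis on the inversion matrix is void, and the algorithm with
\<open>C\<^sub>j(X) = 0\<close> and \<open>N(X) = - 1/X\<close> reaches the minimizer in step \<open>p\<close>; no lower bound growing with
\<open>1/\<epsilon>\<close> can then hold when \<open>\<mu> < L\<close>.\<close>

lemma one_dimensional_exception:
  fixes \<mu> L :: real
  assumes p: "1 \<le> p" and \<mu>: "0 < \<mu>" and L: "\<mu> < L"
  shows "\<exists>\<A>. scli p 1 \<A> \<and> consistent p 1 \<A> {\<mu>..L} \<and> diagonal_inversion 1 \<A> \<and>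
    (\<forall>c>0. \<forall>A \<in> sym_mats 1 {\<mu>..L}. \<forall>b \<in> carrier_vec 1. \<forall>X0 \<in> init_points p 1.
       \<not> Omega_tilde c ((root p (L / \<mu>) - 1) / 2)
          (\<lambda>\<epsilon>. real (iteration_complexity p 1 \<A> \<epsilon> A b X0)))"
proof -
  define N :: "real mat \<Rightarrow> real mat" where "N X = mat 1 1 (\<lambda>_. - 1 / X $$ (0, 0))" for X
  define s :: "real mat \<Rightarrow> draw" where "s X = (\<lambda>j\<in>{..<p}. 0\<^sub>m 1 1, N X)" for X
  define \<A> :: algorithm where "\<A> X = return (draw_space p 1) (s X)" for X
  have s: "s X \<in> space (draw_space p 1)" for X
    by (auto simp: s_def N_def draw_space_def space_pair_measure space_PiM space_mat_borel)
  have prob: "prob_space (\<A> X)" for X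
    unfolding \<A>_def by (rule prob_space_return[OF s])
  have sets: "sets (\<A> X) = sets (draw_space p 1)" for X
    by (simp add: \<A>_def)
  have cm: "(\<lambda>s. fst s j $$ (0, 0)) \<in> borel_measurable (draw_space p 1)" if "j < p" for j
    by (rule coefficient_measurable[OF refl that]) auto
  have nm: "(\<lambda>s. snd s $$ (0, 0)) \<in> borel_measurable (draw_space p 1)"
    by (rule inversion_measurable[OF refl]) auto
  have aeC: "AE t in \<A> X. fst t j $$ (0, 0) = 0" if "j < p" for X j
    unfolding \<A>_def using cm[OF that]
    by (subst AE_return[OF s]) (auto simp: s_def that)
  have aeN: "AE t in \<A> X. snd t $$ (0, 0) = - 1 / X $$ (0, 0)" for X
    unfolding \<A>_def using nm
    by (subst AE_return[OF s]) (auto simp: s_def N_def)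
  have EC: "expectation_mat 1 (\<A> X) (\<lambda>s. fst s j) = 0\<^sub>m 1 1" if "j < p" for X j
  proof -
    have "(\<integral>t. fst t j $$ (0, 0) \<partial>\<A> X) = (\<integral>t. 0 \<partial>\<A> X)"
      by (rule integral_cong_AE) (use cm[OF that] aeC[OF that] in \<open>auto simp: \<A>_def\<close>)
    then show ?thesis by (intro eq_matI) (auto simp: expectation_mat_def)
  qed
  have int: "integrable (\<A> X) f" if "f \<in> borel_measurable (draw_space p 1)"
    and "AE t in \<A> X. f t = c" for X c and f :: "draw \<Rightarrow> real"
  proof -
    interpret prob_space "\<A> X" by (rule prob)
    have "integrable (\<A> X) f \<longleftrightarrow> integrable (\<A> X) (\<lambda>_. c)"
      by (rule integrable_cong_AE) (use that in \<open>auto simp: \<A>_def\<close>)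
    then show ?thesis by simp
  qed
  have scli: "scli p 1 \<A>"
    unfolding scli_def
  proof (intro conjI ballI allI impI prob sets)
    fix A j assume "j < p"
    then show "integrable_mat 1 (\<A> A) (\<lambda>s. fst s j)"
      using int[OF cm aeC] by (auto simp: integrable_mat_def)
  next
    fix A show "integrable_mat 1 (\<A> A) snd"
      using int[OF nm aeN] by (auto simp: integrable_mat_def)
  next
    fix A show "simultaneously_triangularizable 1
        ((\<lambda>j. expectation_mat 1 (\<A> A) (\<lambda>s. fst s j)) ` {..<p})"
      unfolding simultaneously_triangularizable_def
      by (intro bexI[of _ "1\<^sub>m 1"]) (auto simp: inverts_mat_def EC)
  qed
  have diag: "diagonal_inversion 1 \<A>"
    unfolding diagonal_inversion_def
  proof
    fix X :: "real mat"
    show "AE t in \<A> X. diagonal_mat (snd t)"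
      using AE_space[of "\<A> X"]
    proof eventually_elim
      case (elim t)
      from space_draw(2)[OF sets this] show ?case by (auto simp: diagonal_mat_def)
    qed
  qed
  have mean: "mean_iterate p 1 \<A> A b X0 k = quad_minimizer A b"
    if A: "A \<in> sym_mats 1 {\<mu>..L}" and b: "b \<in> carrier_vec 1" and X0: "X0 \<in> init_points p 1"
      and k: "p \<le> k" for A b X0 k
  proof -
    have Ac: "A \<in> carrier_mat 1 1" using A by (simp add: sym_mats_def)
    have "A *\<^sub>v unit_vec 1 0 = A $$ (0, 0) \<cdot>\<^sub>v unit_vec 1 0"
      using Ac by (intro eq_vecI) (auto simp: scalar_prod_def)
    moreover have "(unit_vec 1 0 :: real vec) \<noteq> 0\<^sub>v 1"
      by simp
    ultimately have "eigenvalue A (A $$ (0, 0))"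
      unfolding eigenvalue_def eigenvector_def using Ac by (intro exI[of _ "unit_vec 1 0"]) simp
    then have a: "A $$ (0, 0) \<noteq> 0" using A \<mu> by (auto simp: sym_mats_def)
    have *: "A * N' = 1\<^sub>m 1 \<Longrightarrow> N' \<in> carrier_mat 1 1 \<Longrightarrow> N' $$ (0, 0) = 1 / A $$ (0, 0)" for N'
    proof -
      assume "A * N' = 1\<^sub>m 1" "N' \<in> carrier_mat 1 1"
      then have "(A * N') $$ (0, 0) = 1" by simp
      then show ?thesis using a Ac \<open>N' \<in> carrier_mat 1 1\<close>
        by (auto simp: scalar_prod_def field_simps)
    qed
    obtain B where B: "mat_inverse A = Some B"
    proof (cases "mat_inverse A")
      case None
      define B where "B = mat 1 1 (\<lambda>_. 1 / A $$ (0, 0))"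
      have "A * B = 1\<^sub>m 1" "B * A = 1\<^sub>m 1" "B \<in> carrier_mat 1 1" using Ac a
        by (auto intro!: eq_matI simp: B_def scalar_prod_def)
      then have "A \<in> Units (ring_mat TYPE(real) 1 ())"
        using Ac unfolding Units_def ring_mat_def by auto
      with mat_inverse(1)[OF Ac None, of "()"] show ?thesis by blast
    qed auto
    note B' = mat_inverse(2)[OF Ac B]
    have Bc: "B \<in> carrier_mat 1 1" and B0: "B $$ (0, 0) = 1 / A $$ (0, 0)"
      using B' * by blast+
    have qm: "quad_minimizer A b $ 0 = - 1 / A $$ (0, 0) * b $ 0"
      "dim_vec (quad_minimizer A b) = 1"
      using Bc B0 b unfolding quad_minimizer_def B option.sel
      by (simp_all add: scalar_prod_def)
    have p1: "prob_space (\<Pi>\<^sub>M n\<in>(UNIV :: nat set). \<A> A)"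
      by (rule prob_space_PiM[OF prob])
    interpret prob_space "\<Pi>\<^sub>M n\<in>(UNIV :: nat set). \<A> A" by (rule p1)
    define G where "G t \<longleftrightarrow> t \<in> space (\<A> A) \<and> (\<forall>j<p. fst t j $$ (0, 0) = 0) \<and>
        snd t $$ (0, 0) = - 1 / A $$ (0, 0)" for t
    have "AE t in \<A> A. \<forall>j\<in>{..<p}. fst t j $$ (0, 0) = 0"
      by (rule AE_finite_allI) (simp_all add: aeC)
    with aeN[of A] AE_space[of "\<A> A"] have "AE t in \<A> A. G t"
      by eventually_elim (simp add: G_def)
    then have "AE \<omega> in (\<Pi>\<^sub>M n\<in>UNIV. \<A> A). G (\<omega> k)"
      by (intro AE_PiM_component[where P = G] prob UNIV_I)
    then have ae: "AE \<omega> in (\<Pi>\<^sub>M n\<in>UNIV. \<A> A). iterate p 1 b X0 \<omega> k $ 0 = - 1 / A $$ (0, 0) * b $ 0"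
    proof eventually_elim
      case (elim \<omega>)
      then have sp: "\<omega> k \<in> space (\<A> A)" by (simp add: G_def)
      note s = space_draw[OF sets sp]
      have "iterate p 1 b X0 \<omega> k $ 0 =
          (\<Sum>j<p. \<Sum>l<1. fst (\<omega> k) j $$ (0, l) * iterate p 1 b X0 \<omega> (k - p + j) $ l)
          + (\<Sum>l<1. snd (\<omega> k) $$ (0, l) * b $ l)"
        by (rule iterate_component) (use k X0 b s in auto)
      with elim show ?case by (simp add: G_def)
    qed
    have "(\<integral>\<omega>. iterate p 1 b X0 \<omega> k $ 0 \<partial>(\<Pi>\<^sub>M n\<in>UNIV. \<A> A)) =
        (\<integral>\<omega>. - 1 / A $$ (0, 0) * b $ 0 \<partial>(\<Pi>\<^sub>M n\<in>(UNIV :: nat set). \<A> A))"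
      by (rule integral_cong_AE[OF iterate_measurable[OF sets X0 b] _ ae]) auto
    then show ?thesis
      by (intro eq_vecI) (auto simp: mean_iterate_def expectation_vec_def qm prob_space)
  qed
  have err: "euclid_norm (mean_iterate p 1 \<A> A b X0 k - quad_minimizer A b) = 0"
    if "A \<in> sym_mats 1 {\<mu>..L}" "b \<in> carrier_vec 1" "X0 \<in> init_points p 1" "p \<le> k" for A b X0 k
    unfolding mean[OF that] by (simp add: euclid_norm_def scalar_prod_def)
  have cons: "consistent p 1 \<A> {\<mu>..L}"
    unfolding consistent_def consistent_wrt_def
    by (intro ballI tendsto_eventually eventually_sequentiallyI[of p]) (rule err)
  have ic: "iteration_complexity p 1 \<A> \<epsilon> A b X0 \<le> p"
    if "A \<in> sym_mats 1 {\<mu>..L}" "b \<in> carrier_vec 1" "X0 \<in> init_points p 1" "0 < \<epsilon>" for A b X0 \<epsilon>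
    unfolding iteration_complexity_def by (rule Least_le) (use err[OF that(1-3)] that(4) in auto)
  define R where "R = (root p (L / \<mu>) - 1) / 2"
  have R: "0 < R"
    using p \<mu> L real_root_less_mono[of p 1 "L / \<mu>"] by (simp add: R_def)
  have "\<not> Omega_tilde c R (\<lambda>\<epsilon>. real (iteration_complexity p 1 \<A> \<epsilon> A b X0))"
    if "0 < c" "A \<in> sym_mats 1 {\<mu>..L}" "b \<in> carrier_vec 1" "X0 \<in> init_points p 1" for c A b X0
  proof
    assume "Omega_tilde c R (\<lambda>\<epsilon>. real (iteration_complexity p 1 \<A> \<epsilon> A b X0))"
    then obtain e where e: "0 < e" "\<And>\<epsilon>. 0 < \<epsilon> \<Longrightarrow> \<epsilon> < e \<Longrightarrow>
        c * (R * ln (1 / \<epsilon>)) \<le> real (iteration_complexity p 1 \<A> \<epsilon> A b X0)"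
      unfolding Omega_tilde_def by blast
    define \<epsilon> where "\<epsilon> = min (e / 2) (exp (- ((real p + 1) / (c * R))))"
    have \<epsilon>: "0 < \<epsilon>" "\<epsilon> < e" using e(1) by (auto simp: \<epsilon>_def)
    have "ln \<epsilon> \<le> - ((real p + 1) / (c * R))"
      using \<epsilon>(1) ln_mono[of \<epsilon> "exp (- ((real p + 1) / (c * R)))"] by (simp add: \<epsilon>_def)
    then have "(real p + 1) / (c * R) \<le> ln (1 / \<epsilon>)" using \<epsilon>(1) by (simp add: ln_div)
    then have "real p + 1 \<le> c * (R * ln (1 / \<epsilon>))"
      using \<open>0 < c\<close> R by (simp add: pos_divide_le_eq mult_ac)
    with e(2)[OF \<epsilon>] ic[OF that(2-4) \<epsilon>(1)] show False by simp
  qed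
  with scli cons diag show ?thesis unfolding R_def by blast
qed

end

theory Submission
  imports Defs
begin

text \<open>Averaging the iteration, \<open>\<E> x\<^sup>k\<close> satisfies the deterministic recursion with coefficients \<open>\<E> C\<^sub>j\<close>, since
each draw is independent of the past. Consistency forces \<open>I - (\<Sum>j. \<E> C\<^sub>j) = - \<E> N * A\<close>. After simultaneous
triangularization, the eigenvalues of \<open>- \<E> N * A\<close> are the values at \<open>1\<close> of the characteristic
polynomials of \<open>d\<close> scalar recurrences of order \<open>p\<close>, so if the roots have modulus at most \<open>\<rho> < 1\<close>, these
eigenvalues are positive and lie between \<open>(1 - \<rho>)\<^sup>p\<close> and \<open>(1 + \<rho>)\<^sup>p\<close>. Now take for \<open>A\<close> the matrix which has the
eigenvalues \<open>L\<close> and \<open>\<mu>\<close> on the span of the first two unit vectors, with eigenvectors \<open>(1, 1)\<close> and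
\<open>(1, -1)\<close>. Its two relevant diagonal entries are equal, so a diagonal scaling cannot improve
the condition number: two of the eigenvalues have ratio at least \<open>\<kappa>\<close>. Hence
\<open>\<kappa> \<le> ((1 + \<rho>) / (1 - \<rho>))\<^sup>p\<close>, which is \<open>(root p \<kappa> - 1) / 2 \<le> \<rho> / (1 - \<rho>)\<close>, and the right side is at most
\<open>1 / ln (1 / \<rho>)\<close>. For \<open>b = 0\<close>, suitable initialization points make the error decay no faster than \<open>\<rho>\<^sup>k\<close>.\<close>

section \<open>The recursion of the mean iterates\<close>

text \<open>Independence amounts to the joint law being the product of the marginals:
  \<open>restrict x I\<close> is the identity on the product space, and each marginal is the factor
  \<open>M i\<close>.\<close>

lemma indep_vars_coordinates:
  assumes "I \<noteq> {}" and M: "\<And>i. i \<in> I \<Longrightarrow> prob_space (M i)"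
  shows "prob_space.indep_vars (PiM I M) M (\<lambda>i \<omega>. \<omega> i) I"
proof -
  interpret prob_space "PiM I M" by (rule prob_space_PiM[OF M])
  have "distr (PiM I M) (PiM I M) (\<lambda>x. restrict x I) = distr (PiM I M) (PiM I M) (\<lambda>x. x)"
    by (rule distr_cong) (auto simp: space_PiM)
  also have "\<dots> = PiM I M" by (rule distr_id)
  also have "\<dots> = PiM I (\<lambda>i. distr (PiM I M) (M i) (\<lambda>\<omega>. \<omega> i))"
    by (rule PiM_cong[OF refl]) (rule distr_PiM_component[OF M, symmetric])
  finally show ?thesis
    by (subst indep_vars_iff_distr_eq_PiM'[OF assms(1)]) (rule measurable_component_singleton)
qed

lemma iterate_cong:
  "(\<And>n. p \<le> n \<Longrightarrow> n \<le> k \<Longrightarrow> \<omega> n = \<omega>' n) \<Longrightarrow> iterate p d b X0 \<omega> k = iterate p d b X0 \<omega>' k"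
proof (induction k rule: less_induct)
  case (less k)
  show ?case
  proof (cases "k < p")
    case False
    have "iterate p d b X0 \<omega> (k - p + j) = iterate p d b X0 \<omega>' (k - p + j)" if "j < p" for j
      using that False by (intro less.IH less.prems) auto
    moreover have "\<omega> k = \<omega>' k" using False by (intro less.prems) auto
    ultimately show ?thesis by (subst (1 2) iterate.simps) (simp add: False)
  qed (simp add: iterate.simps)
qed

text \<open>An iterate with index \<open>n < k\<close> is a function of the draws in
  \<open>{..<k}\<close>, a block disjoint from \<open>{k}\<close>, and functions of disjoint blocks
  of independent variables are independent.\<close>

lemma indep_draw_iterate:
  assumes M: "prob_space M" "sets M = sets (draw_space p d)" and X0: "X0 \<in> init_points p d"
    and b: "b \<in> carrier_vec d" and l: "l < d" and n: "n < k"
    and f: "f \<in> borel_measurable M"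
  shows "prob_space.indep_var (\<Pi>\<^sub>M n\<in>UNIV. M) borel (\<lambda>\<omega>. f (\<omega> k))
    borel (\<lambda>\<omega>. iterate p d b X0 \<omega> n $ l)"
proof -
  let ?P = "\<Pi>\<^sub>M n\<in>(UNIV :: nat set). M"
  interpret M: prob_space M by (rule M)
  interpret prob_space ?P by (rule prob_space_PiM[OF M(1)])
  obtain s where s: "s \<in> space M" using M.not_empty by blast
  \<comment> \<open>Filling up with the fixed draw \<open>s\<close> turns the past iterate into a
    measurable function on the product over \<open>{..<k}\<close>.\<close>
  define ext :: "(nat \<Rightarrow> draw) \<Rightarrow> nat \<Rightarrow> draw" where
    "ext \<omega> = (\<lambda>m. if m < k then \<omega> m else s)" for \<omega>
  have "ext \<in> measurable (PiM {..<k} (\<lambda>_. M)) ?P"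
  proof (rule measurable_PiM_single')
    fix i :: nat
    show "(\<lambda>\<omega>. ext \<omega> i) \<in> measurable (PiM {..<k} (\<lambda>_. M)) M"
      using s by (cases "i < k") (simp_all add: ext_def)
  next
    show "ext \<in> space (PiM {..<k} (\<lambda>_. M)) \<rightarrow> (\<Pi>\<^sub>E i\<in>UNIV. space M)"
      unfolding PiE_UNIV_domain space_PiM ext_def using s by (intro funcsetI) (auto dest: PiE_mem)
  qed
  from measurable_compose[OF this iterate_measurable[OF M(2) X0 b l]]
  have 1: "(\<lambda>\<omega>. iterate p d b X0 (ext \<omega>) n $ l) \<in> borel_measurable (PiM {..<k} (\<lambda>_. M))" .
  have 2: "(\<lambda>\<omega>. f (\<omega> k)) \<in> borel_measurable (PiM {k} (\<lambda>_. M))"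
    by (rule measurable_compose[OF measurable_component_singleton[of k "{k}" "\<lambda>_. M"] f]) simp
  have "indep_var (PiM {k} (\<lambda>_. M)) (\<lambda>\<omega>. restrict (\<lambda>i. \<omega> i) {k})
      (PiM {..<k} (\<lambda>_. M)) (\<lambda>\<omega>. restrict (\<lambda>i. \<omega> i) {..<k})"
    by (rule indep_var_restrict[OF indep_vars_coordinates]) (auto simp: M)
  from indep_var_compose[OF this 2 1]
  have "indep_var borel (\<lambda>\<omega>. f (\<omega> k)) borel (\<lambda>\<omega>. iterate p d b X0 (ext (restrict \<omega> {..<k})) n $ l)"
    by (simp add: o_def)
  moreover have "iterate p d b X0 (ext (restrict \<omega> {..<k})) n = iterate p d b X0 \<omega> n" for \<omega>
    using n by (intro iterate_cong) (auto simp: ext_def)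
  ultimately show ?thesis by simp
qed

text \<open>Integrability propagates along the recursion because a product of independent integrable
  variables is integrable; its expectation is then the product of the two expectations.\<close>

lemma
  assumes M: "prob_space M" "sets M = sets (draw_space p d)" and X0: "X0 \<in> init_points p d"
    and b: "b \<in> carrier_vec d"
    and C: "\<And>j. j < p \<Longrightarrow> integrable_mat d M (\<lambda>s. fst s j)" and N: "integrable_mat d M snd"
  shows integrable_iterate:
      "l < d \<Longrightarrow> integrable (\<Pi>\<^sub>M n\<in>UNIV. M) (\<lambda>\<omega>. iterate p d b X0 \<omega> k $ l)"
    and expectation_iterate:
      "i < d \<Longrightarrow> p \<le> k \<Longrightarrow> (\<integral>\<omega>. iterate p d b X0 \<omega> k $ i \<partial>(\<Pi>\<^sub>M n\<in>UNIV. M)) =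
        (\<Sum>j<p. \<Sum>l<d. expectation_mat d M (\<lambda>s. fst s j) $$ (i, l) *
            (\<integral>\<omega>. iterate p d b X0 \<omega> (k - p + j) $ l \<partial>(\<Pi>\<^sub>M n\<in>UNIV. M)))
        + (\<Sum>l<d. expectation_mat d M snd $$ (i, l) * b $ l)"
proof -
  let ?P = "\<Pi>\<^sub>M n\<in>(UNIV :: nat set). M"
  interpret prob_space ?P by (rule prob_space_PiM[OF M(1)])
  \<comment> \<open>Each coordinate has law \<open>M\<close>, so integrals of functions of one draw
    reduce to integrals over \<open>M\<close>.\<close>
  have transfer: "integrable ?P (\<lambda>\<omega>. f (\<omega> k)) \<and> (\<integral>\<omega>. f (\<omega> k) \<partial>?P) = (\<integral>s. f s \<partial>M)"
    if "integrable M f" for f :: "draw \<Rightarrow> real" and k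
  proof -
    have "distr ?P M (\<lambda>\<omega>. \<omega> k) = M" by (rule distr_PiM_component) (auto simp: M)
    moreover have "(\<lambda>\<omega>. \<omega> k) \<in> measurable ?P M" by measurable
    ultimately show ?thesis
      using that integrable_distr[of "\<lambda>\<omega>. \<omega> k" ?P M f] integral_distr[of "\<lambda>\<omega>. \<omega> k" ?P M f] by auto
  qed
  have C': "integrable M (\<lambda>s. fst s j $$ (i, l))" if "j < p" "i < d" "l < d" for j i l
    using C that by (auto simp: integrable_mat_def)
  have N': "integrable M (\<lambda>s. snd s $$ (i, l))" if "i < d" "l < d" for i l
    using N that by (auto simp: integrable_mat_def)
  define E where "E k \<omega> i = (\<Sum>j<p. \<Sum>l<d. fst (\<omega> k) j $$ (i, l) * iterate p d b X0 \<omega> (k - p + j) $ l)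
        + (\<Sum>l<d. snd (\<omega> k) $$ (i, l) * b $ l)" for k \<omega> i
  have E: "iterate p d b X0 \<omega> k $ i = E k \<omega> i" if "p \<le> k" "i < d" "\<omega> \<in> space ?P" for \<omega> k i
  proof -
    have "\<omega> k \<in> space M" using that by (auto simp: space_PiM)
    note s = space_draw[OF M(2) this]
    show ?thesis unfolding E_def
      by (rule iterate_component[OF _ X0 b]) (use that s in auto)
  qed
  have prod: "integrable ?P (\<lambda>\<omega>. fst (\<omega> k) j $$ (i, l) * iterate p d b X0 \<omega> (k - p + j) $ l)"
      "(\<integral>\<omega>. fst (\<omega> k) j $$ (i, l) * iterate p d b X0 \<omega> (k - p + j) $ l \<partial>?P) =
        expectation_mat d M (\<lambda>s. fst s j) $$ (i, l) * (\<integral>\<omega>. iterate p d b X0 \<omega> (k - p + j) $ l \<partial>?P)"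
    if "p \<le> k" "j < p" "i < d" "l < d"
      and I: "integrable ?P (\<lambda>\<omega>. iterate p d b X0 \<omega> (k - p + j) $ l)" for k j i l
  proof -
    have ind: "indep_var borel (\<lambda>\<omega>. fst (\<omega> k) j $$ (i, l))
        borel (\<lambda>\<omega>. iterate p d b X0 \<omega> (k - p + j) $ l)"
      by (rule indep_draw_iterate[OF M X0 b])
         (use that coefficient_measurable[OF M(2)] in auto)
    note t = transfer[OF C'[OF that(2-4)], of k]
    show "integrable ?P (\<lambda>\<omega>. fst (\<omega> k) j $$ (i, l) * iterate p d b X0 \<omega> (k - p + j) $ l)"
      using indep_var_integrable[OF ind _ I] t by blast
    show "(\<integral>\<omega>. fst (\<omega> k) j $$ (i, l) * iterate p d b X0 \<omega> (k - p + j) $ l \<partial>?P) =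
        expectation_mat d M (\<lambda>s. fst s j) $$ (i, l) * (\<integral>\<omega>. iterate p d b X0 \<omega> (k - p + j) $ l \<partial>?P)"
      using indep_var_lebesgue_integral[OF ind _ I] t that by (simp add: expectation_mat_def)
  qed
  have int: "integrable ?P (\<lambda>\<omega>. iterate p d b X0 \<omega> k $ l)" if "l < d" for k l
    using that
  proof (induction k arbitrary: l rule: less_induct)
    case (less k)
    show ?case
    proof (cases "k < p")
      case True
      then show ?thesis by (subst iterate.simps) simp
    next
      case False
      have "integrable ?P (\<lambda>\<omega>. E k \<omega> l)"
        unfolding E_def
        by (intro Bochner_Integration.integrable_add Bochner_Integration.integrable_sum prod(1)
              integrable_mult_left)
           (use False less transfer[OF N'] in auto)
      then show ?thesis
        using E[of k l] False less.prems by (simp cong: Bochner_Integration.integrable_cong)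
    qed
  qed
  show "l < d \<Longrightarrow> integrable ?P (\<lambda>\<omega>. iterate p d b X0 \<omega> k $ l)" by (rule int)
  assume i: "i < d" and k: "p \<le> k"
  have "(\<integral>\<omega>. iterate p d b X0 \<omega> k $ i \<partial>?P) = (\<integral>\<omega>. E k \<omega> i \<partial>?P)"
    by (rule Bochner_Integration.integral_cong) (use E[OF k i] in auto)
  also have "\<dots> = (\<Sum>j<p. \<Sum>l<d. \<integral>\<omega>. fst (\<omega> k) j $$ (i, l) * iterate p d b X0 \<omega> (k - p + j) $ l \<partial>?P)
        + (\<Sum>l<d. \<integral>\<omega>. snd (\<omega> k) $$ (i, l) * b $ l \<partial>?P)"
  proof -
    have 1: "integrable ?P (\<lambda>\<omega>. fst (\<omega> k) j $$ (i, l) * iterate p d b X0 \<omega> (k - p + j) $ l)"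
      if "j < p" "l < d" for j l
      by (rule prod(1)[OF k that(1) i that(2) int[OF that(2)]])
    have 2: "integrable ?P (\<lambda>\<omega>. snd (\<omega> k) $$ (i, l) * b $ l)" if "l < d" for l
      using transfer[OF N'[OF i that]] by simp
    have "(\<integral>\<omega>. E k \<omega> i \<partial>?P) =
        (\<integral>\<omega>. (\<Sum>j<p. \<Sum>l<d. fst (\<omega> k) j $$ (i, l) * iterate p d b X0 \<omega> (k - p + j) $ l) \<partial>?P)
        + (\<integral>\<omega>. (\<Sum>l<d. snd (\<omega> k) $$ (i, l) * b $ l) \<partial>?P)"
      unfolding E_def
      by (intro Bochner_Integration.integral_add Bochner_Integration.integrable_sum 1 2) auto
    also have "(\<integral>\<omega>. (\<Sum>j<p. \<Sum>l<d. fst (\<omega> k) j $$ (i, l) * iterate p d b X0 \<omega> (k - p + j) $ l) \<partial>?P)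
        = (\<Sum>j<p. \<integral>\<omega>. (\<Sum>l<d. fst (\<omega> k) j $$ (i, l) * iterate p d b X0 \<omega> (k - p + j) $ l) \<partial>?P)"
      by (intro Bochner_Integration.integral_sum Bochner_Integration.integrable_sum 1) auto
    also have "\<dots> = (\<Sum>j<p. \<Sum>l<d. \<integral>\<omega>. fst (\<omega> k) j $$ (i, l) * iterate p d b X0 \<omega> (k - p + j) $ l \<partial>?P)"
      by (intro sum.cong refl Bochner_Integration.integral_sum 1) auto
    also have "(\<integral>\<omega>. (\<Sum>l<d. snd (\<omega> k) $$ (i, l) * b $ l) \<partial>?P)
        = (\<Sum>l<d. \<integral>\<omega>. snd (\<omega> k) $$ (i, l) * b $ l \<partial>?P)"
      by (intro Bochner_Integration.integral_sum 2) auto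
    finally show ?thesis .
  qed
  also have "(\<Sum>l<d. \<integral>\<omega>. snd (\<omega> k) $$ (i, l) * b $ l \<partial>?P) =
      (\<Sum>l<d. expectation_mat d M snd $$ (i, l) * b $ l)"
    using i transfer[OF N'] by (intro sum.cong) (auto simp: expectation_mat_def)
  also have "(\<Sum>j<p. \<Sum>l<d. \<integral>\<omega>. fst (\<omega> k) j $$ (i, l) * iterate p d b X0 \<omega> (k - p + j) $ l \<partial>?P) =
      (\<Sum>j<p. \<Sum>l<d. expectation_mat d M (\<lambda>s. fst s j) $$ (i, l) *
            (\<integral>\<omega>. iterate p d b X0 \<omega> (k - p + j) $ l \<partial>?P))"
    by (intro sum.cong refl prod(2) int) (use i k in auto)
  finally show "(\<integral>\<omega>. iterate p d b X0 \<omega> k $ i \<partial>?P) =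
        (\<Sum>j<p. \<Sum>l<d. expectation_mat d M (\<lambda>s. fst s j) $$ (i, l) *
            (\<integral>\<omega>. iterate p d b X0 \<omega> (k - p + j) $ l \<partial>?P))
        + (\<Sum>l<d. expectation_mat d M snd $$ (i, l) * b $ l)" .
qed

section \<open>Roots of monic polynomials and linear recurrences\<close>

text \<open>Over the complex numbers \<open>q\<close> splits into monic linear factors, each of
  which has at \<open>1\<close> a modulus between \<open>1 - \<rho>\<close> and
  \<open>1 + \<rho>\<close>.\<close>

lemma norm_poly_one_bounds:
  fixes q :: "complex poly"
  assumes q: "lead_coeff q = 1" and \<rho>: "\<rho> \<le> 1" and roots: "\<And>z. poly q z = 0 \<Longrightarrow> cmod z \<le> \<rho>"
  shows "(1 - \<rho>) ^ degree q \<le> cmod (poly q 1)" "cmod (poly q 1) \<le> (1 + \<rho>) ^ degree q"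
proof -
  from q have "q \<noteq> 0" by auto
  then obtain A where A: "size A = degree q" "q = Polynomial.smult (lead_coeff q) (\<Prod>x\<in>#A. [:-x, 1:])"
    using alg_closed_imp_factorization by blast
  then have qA: "q = (\<Prod>x\<in>#A. [:-x, 1:])" using q by simp
  have "cmod x \<le> \<rho>" if "x \<in># A" for x
    by (rule roots, subst qA) (use that in \<open>auto simp: poly_prod_mset prod_mset_zero_iff\<close>)
  then have "(1 - \<rho>) ^ size A \<le> cmod (poly (\<Prod>x\<in>#A. [:-x, 1:]) 1) \<and>
      cmod (poly (\<Prod>x\<in>#A. [:-x, 1:]) 1) \<le> (1 + \<rho>) ^ size A"
  proof (induction A)
    case (add x A)
    have x: "cmod x \<le> \<rho>" using add.prems by simp
    have "1 - \<rho> \<le> cmod (1 - x)" using x norm_triangle_ineq2[of 1 x] by simp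
    moreover have "cmod (1 - x) \<le> 1 + \<rho>" using x norm_triangle_ineq4[of 1 x] by simp
    \<comment> \<open>Nonnegativity of \<open>\<rho>\<close> comes from the modulus of the root
      \<open>x\<close>.\<close>
    moreover have "0 \<le> 1 - \<rho>" "0 \<le> 1 + \<rho>" using \<rho> order_trans[OF norm_ge_zero x] by simp_all
    moreover define w where "w = poly (\<Prod>x\<in>#A. [:-x, 1:]) 1"
    have "(1 - \<rho>) ^ size A \<le> cmod w" "cmod w \<le> (1 + \<rho>) ^ size A"
      using add by (auto simp: w_def)
    ultimately have "(1 - \<rho>) * (1 - \<rho>) ^ size A \<le> cmod (1 - x) * cmod w"
        "cmod (1 - x) * cmod w \<le> (1 + \<rho>) * (1 + \<rho>) ^ size A"
      by (intro mult_mono; simp)+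
    moreover have "poly (\<Prod>x\<in>#add_mset x A. [:-x, 1:]) 1 = (1 - x) * w"
      by (simp add: w_def algebra_simps)
    ultimately show ?case by (simp only: norm_mult size_add_mset power_Suc simp_thms)
  qed simp
  then show "(1 - \<rho>) ^ degree q \<le> cmod (poly q 1)" "cmod (poly q 1) \<le> (1 + \<rho>) ^ degree q"
    using A(1) qA by auto
qed

text \<open>The polynomial is positive far to the right, so a nonpositive value at \<open>1\<close>
  would produce a root that is at least \<open>1\<close>, by the intermediate value theorem.\<close>

lemma poly_one_pos:
  fixes q :: "real poly"
  assumes "lead_coeff q > 0" and "\<And>x. poly q x = 0 \<Longrightarrow> x < 1"
  shows "poly q 1 > 0"
proof (rule ccontr)
  assume *: "\<not> poly q 1 > 0"
  obtain n where n: "\<And>x. n \<le> x \<Longrightarrow> poly q x \<ge> lead_coeff q"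
    using poly_pinfty_gt_lc[OF assms(1)] by blast
  \<comment> \<open>The \<open>2\<close> keeps the right end of the interval above
    \<open>1\<close>.\<close>
  have "poly q (max n 2) > 0" using n[of "max n 2"] assms(1) by simp
  moreover have "poly q 1 < 0" using * assms(2)[of 1] by (cases "poly q 1" "0 :: real" rule: linorder_cases) auto
  ultimately obtain x where "1 < x" "poly q x = 0"
    using poly_IVT_pos[of 1 "max n 2" q] by (metis less_max_iff_disj one_less_numeral_iff semiring_norm(76))
  with assms(2)[of x] show False by simp
qed

section \<open>Characteristic polynomials of scalar recurrences\<close>

text \<open>Generic in the ring: over the reals its sign at \<open>1\<close> is wanted, over the
  complex numbers its roots.\<close>

definition rec_poly :: "nat \<Rightarrow> (nat \<Rightarrow> 'a) \<Rightarrow> 'a::comm_ring_1 poly" where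
  "rec_poly p t = monom 1 p - (\<Sum>j<p. monom (t j) j)"

lemma poly_rec_poly: "poly (rec_poly p t) z = z ^ p - (\<Sum>j<p. t j * z ^ j)"
  by (simp add: rec_poly_def poly_sum poly_monom)

lemma coeff_rec_poly:
  "coeff (rec_poly p t) n = (if n = p then 1 else if n < p then - t n else 0)"
proof -
  have "(\<Sum>j<p. coeff (monom (t j) j) n) = (if n < p then t n else 0)"
    by (simp add: coeff_monom)
  then show ?thesis by (simp add: rec_poly_def coeff_sum coeff_monom)
qed

lemma degree_rec_poly [simp]: "degree (rec_poly p t) = p"
proof (rule antisym)
  show "degree (rec_poly p t) \<le> p" by (rule degree_le) (auto simp: coeff_rec_poly)
  show "p \<le> degree (rec_poly p t)" by (rule le_degree) (simp add: coeff_rec_poly)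
qed

text \<open>The characteristic roots of the recurrence \<open>u\<^sub>k = (\<Sum>j<p. t\<^sub>j * u\<^sub>k\<^sub>-\<^sub>p\<^sub>+\<^sub>j)\<close>.\<close>

definition rec_roots :: "nat \<Rightarrow> (nat \<Rightarrow> real) \<Rightarrow> complex set" where
  "rec_roots p t = {z. z ^ p = (\<Sum>j<p. of_real (t j) * z ^ j)}"

lemma rec_roots_eq: "rec_roots p t = {z. poly (rec_poly p (\<lambda>j. complex_of_real (t j))) z = 0}"
  by (simp add: rec_roots_def poly_rec_poly)

lemma finite_rec_roots: "finite (rec_roots p t)"
proof -
  have "coeff (rec_poly p (\<lambda>j. complex_of_real (t j))) p = 1" by (simp add: coeff_rec_poly)
  then have "rec_poly p (\<lambda>j. complex_of_real (t j)) \<noteq> 0" by auto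
  then show ?thesis unfolding rec_roots_eq by (rule poly_roots_finite)
qed

lemma rec_roots_nonempty:
  assumes "1 \<le> p"
  shows "rec_roots p t \<noteq> {}"
proof -
  have "\<not> constant (poly (rec_poly p (\<lambda>j. complex_of_real (t j))))"
    using assms by (simp add: constant_degree)
  then show ?thesis using fundamental_theorem_of_algebra unfolding rec_roots_eq by blast
qed

text \<open>This number is the value at \<open>1\<close> of the monic real characteristic
  polynomial, whose real roots all lie below \<open>1\<close>.\<close>

lemma one_minus_sum_pos:
  assumes "\<And>z. z \<in> rec_roots p t \<Longrightarrow> cmod z < 1"
  shows "0 < 1 - (\<Sum>j<p. t j)"
proof -
  have "0 < poly (rec_poly p t) 1"
  proof (rule poly_one_pos)
    fix x assume "poly (rec_poly p t) x = 0"
    then have "of_real (x ^ p) = (of_real (\<Sum>j<p. t j * x ^ j) :: complex)"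
      by (simp add: poly_rec_poly del: of_real_power of_real_sum)
    then have "complex_of_real x \<in> rec_roots p t" by (simp add: rec_roots_def)
    from assms[OF this] show "x < 1" by simp
  qed (simp add: coeff_rec_poly)
  then show ?thesis by (simp add: poly_rec_poly)
qed

text \<open>Being positive, the value at \<open>1\<close> equals its modulus, to which the bounds
  from the complex factorization apply.\<close>

lemma one_minus_sum_bounds:
  assumes "\<And>z. z \<in> rec_roots p t \<Longrightarrow> cmod z \<le> \<rho>" and "\<rho> < 1"
  shows "(1 - \<rho>) ^ p \<le> 1 - (\<Sum>j<p. t j)" "1 - (\<Sum>j<p. t j) \<le> (1 + \<rho>) ^ p"
proof -
  have "0 < 1 - (\<Sum>j<p. t j)"
    by (rule one_minus_sum_pos) (use assms in force)
  moreover have "poly (rec_poly p (\<lambda>j. complex_of_real (t j))) 1 = of_real (1 - (\<Sum>j<p. t j))"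
    by (simp add: poly_rec_poly)
  ultimately have "cmod (poly (rec_poly p (\<lambda>j. complex_of_real (t j))) 1) = 1 - (\<Sum>j<p. t j)"
    by (simp only: norm_of_real abs_of_pos)
  with norm_poly_one_bounds[of "rec_poly p (\<lambda>j. complex_of_real (t j))" \<rho>] assms
  show "(1 - \<rho>) ^ p \<le> 1 - (\<Sum>j<p. t j)" "1 - (\<Sum>j<p. t j) \<le> (1 + \<rho>) ^ p"
    by (auto simp: rec_roots_eq coeff_rec_poly)
qed

text \<open>Powers of a root solve the recurrence; since the \<open>t j\<close> are real, so do
  their real parts. This yields real initialization points even for a nonreal root.\<close>

lemma Re_power_recurrence:
  assumes "z \<in> rec_roots p t" "p \<le> k"
  shows "Re (z ^ k) = (\<Sum>j<p. t j * Re (z ^ (k - p + j)))"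
proof -
  have "z ^ k = z ^ (k - p) * z ^ p" using assms(2) by (simp flip: power_add)
  also have "\<dots> = (\<Sum>j<p. of_real (t j) * z ^ (k - p + j))"
    using assms(1) by (simp add: rec_roots_def sum_distrib_left power_add mult_ac)
  finally show ?thesis by simp
qed

text \<open>The real part of one power of \<open>z\<close> may vanish, but not those of two consecutive powers.\<close>

lemma norm_power_le_Re_powers:
  obtains B where "0 < B"
    and "\<And>k \<eta>. \<bar>Re (z ^ k)\<bar> \<le> \<eta> \<Longrightarrow> \<bar>Re (z ^ Suc k)\<bar> \<le> \<eta> \<Longrightarrow> cmod z ^ k \<le> B * \<eta>"
proof (cases "Im z = 0")
  case True
  then have "z = of_real (Re z)" by (simp add: complex_eq_iff)
  then have "\<bar>Re (z ^ k)\<bar> = cmod z ^ k" for k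
    by (metis Re_complex_of_real norm_of_real of_real_power power_abs)
  then show ?thesis by (intro that[of 1]) auto
next
  case False
  define B where "B = (\<bar>Im z\<bar> + 1 + \<bar>Re z\<bar>) / \<bar>Im z\<bar>"
  show ?thesis
  proof (rule that[of B])
    show "0 < B" using False by (simp add: B_def add_pos_nonneg)
    fix k \<eta> assume 1: "\<bar>Re (z ^ k)\<bar> \<le> \<eta>" and 2: "\<bar>Re (z ^ Suc k)\<bar> \<le> \<eta>"
    \<comment> \<open>The real part of \<open>z * z ^ k\<close>, solved for the term with
      \<open>Im (z ^ k)\<close>: two consecutive real parts control the imaginary part.\<close>
    have "Im z * Im (z ^ k) = Re z * Re (z ^ k) - Re (z ^ Suc k)" by simp
    then have "\<bar>Im z\<bar> * \<bar>Im (z ^ k)\<bar> \<le> \<bar>Re z\<bar> * \<bar>Re (z ^ k)\<bar> + \<bar>Re (z ^ Suc k)\<bar>"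
      by (metis abs_mult abs_triangle_ineq4)
    also have "\<dots> \<le> \<bar>Re z\<bar> * \<eta> + \<eta>" by (intro add_mono mult_left_mono 1 2) simp
    finally have 3: "\<bar>Im z\<bar> * \<bar>Im (z ^ k)\<bar> \<le> \<bar>Re z\<bar> * \<eta> + \<eta>" .
    have "\<bar>Im z\<bar> * cmod z ^ k \<le> \<bar>Im z\<bar> * (\<bar>Re (z ^ k)\<bar> + \<bar>Im (z ^ k)\<bar>)"
      by (intro mult_left_mono) (simp_all add: cmod_le flip: norm_power)
    also have "\<dots> \<le> \<bar>Im z\<bar> * \<eta> + (\<bar>Re z\<bar> * \<eta> + \<eta>)"
      using 3 mult_left_mono[OF 1, of "\<bar>Im z\<bar>"] by (simp add: distrib_left)
    finally show "cmod z ^ k \<le> B * \<eta>"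
      using False by (simp add: B_def field_simps)
  qed
qed

section \<open>From geometric decay to iteration complexity\<close>

text \<open>Logarithms turn the decay into a lower bound \<open>ln (1 / \<epsilon>) - ln B\<close>
  for \<open>real (g \<epsilon>) * ln (1 / \<rho>)\<close>, and \<open>ln x \<le> x - 1\<close>
  turns the bound on \<open>R\<close> into \<open>R * ln (1 / \<rho>) \<le> 1\<close>.\<close>

lemma Omega_tilde_geometric:
  assumes \<rho>: "0 < \<rho>" "\<rho> < 1" and B: "0 < B" and R: "0 \<le> R" "R \<le> \<rho> / (1 - \<rho>)"
    and g: "\<And>\<epsilon>. 0 < \<epsilon> \<Longrightarrow> \<rho> ^ g \<epsilon> \<le> B * \<epsilon>"
  shows "Omega_tilde (1 / 2) R (\<lambda>\<epsilon>. real (g \<epsilon>))"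
  unfolding Omega_tilde_def
proof (intro exI conjI allI impI)
  \<comment> \<open>Below \<open>1 / B\<^sup>2\<close> the term \<open>ln B\<close> is at most half
    of \<open>ln (1 / \<epsilon>)\<close>; this loss is the constant \<open>1 / 2\<close>.\<close>
  define e where "e = min (1 / 2) (1 / B\<^sup>2)"
  show "0 < e" "e < 1" using B by (auto simp: e_def)
  fix \<epsilon> assume \<epsilon>: "0 < \<epsilon> \<and> \<epsilon> < e"
  then have "\<epsilon> \<le> 1 / B\<^sup>2" "\<epsilon> < 1" by (auto simp: e_def)
  then have "ln \<epsilon> \<le> ln (1 / B\<^sup>2)" using \<epsilon> B by (subst ln_le_cancel_iff) auto
  then have lnB: "2 * ln B \<le> ln (1 / \<epsilon>)" using \<epsilon> B by (simp add: ln_div ln_realpow)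
  have "ln (\<rho> ^ g \<epsilon>) \<le> ln (B * \<epsilon>)" using g[of \<epsilon>] \<rho> \<epsilon> B by (subst ln_le_cancel_iff) auto
  then have 1: "ln (1 / \<epsilon>) / 2 \<le> real (g \<epsilon>) * ln (1 / \<rho>)"
    using lnB \<rho> \<epsilon> B by (simp add: ln_realpow ln_mult ln_div)
  have "ln (1 / \<rho>) \<le> 1 / \<rho> - 1" by (rule ln_le_minus_one) (use \<rho> in simp)
  also have "1 / \<rho> - 1 = (1 - \<rho>) / \<rho>" using \<rho> by (simp add: diff_divide_distrib)
  finally have "R * ln (1 / \<rho>) \<le> \<rho> / (1 - \<rho>) * ((1 - \<rho>) / \<rho>)"
    using R \<rho> by (intro mult_mono) auto
  then have 2: "R * ln (1 / \<rho>) \<le> 1" using \<rho> by simp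
  have "1 / 2 * (R * ln (1 / \<epsilon>)) = R * (ln (1 / \<epsilon>) / 2)" by simp
  also have "\<dots> \<le> R * (real (g \<epsilon>) * ln (1 / \<rho>))" using 1 R by (intro mult_left_mono) auto
  also have "\<dots> = real (g \<epsilon>) * (R * ln (1 / \<rho>))" by simp
  also have "\<dots> \<le> real (g \<epsilon>) * 1" using 2 by (intro mult_left_mono) auto
  finally show "1 / 2 * (R * ln (1 / \<epsilon>)) \<le> real (g \<epsilon>)" by simp
qed

text \<open>The chain \<open>\<kappa> * (1 - \<rho>) ^ p \<le> \<kappa> * s' \<le> s \<le> (1 +
  \<rho>) ^ p\<close> is reduced to a linear inequality by taking \<open>p\<close>-th roots.\<close>

lemma rate_bound:
  assumes p: "1 \<le> p" and \<kappa>: "1 \<le> \<kappa>" and \<rho>: "0 \<le> \<rho>" "\<rho> < 1"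
    and s: "s \<le> (1 + \<rho>) ^ p" "(1 - \<rho>) ^ p \<le> s'" "\<kappa> * s' \<le> s"
  shows "(root p \<kappa> - 1) / 2 \<le> \<rho> / (1 - \<rho>)"
proof -
  have "\<kappa> * (1 - \<rho>) ^ p \<le> (1 + \<rho>) ^ p"
    using s \<kappa> mult_left_mono[OF s(2), of \<kappa>] by linarith
  then have "root p (\<kappa> * (1 - \<rho>) ^ p) \<le> root p ((1 + \<rho>) ^ p)"
    using p by (subst real_root_le_iff) auto
  then have "root p \<kappa> * (1 - \<rho>) \<le> 1 + \<rho>"
    using p \<rho> by (simp add: real_root_mult real_root_power_cancel)
  then show ?thesis using \<rho> by (simp add: field_simps)
qed

section \<open>A symmetric matrix not improved by diagonal scaling\<close>

lemma index_mult_mat_sum: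
  assumes "M \<in> carrier_mat n m" "N \<in> carrier_mat m k" "i < n" "j < k"
  shows "(M * N) $$ (i, j) = (\<Sum>l<m. M $$ (i, l) * N $$ (l, j))"
  using assms by (auto simp: scalar_prod_def atLeast0LessThan)

lemma index_mult_mat_vec_sum:
  assumes "M \<in> carrier_mat n m" "v \<in> carrier_vec m" "i < n"
  shows "(M *\<^sub>v v) $ i = (\<Sum>l<m. M $$ (i, l) * v $ l)"
  using assms by (auto simp: scalar_prod_def atLeast0LessThan)

lemma index_conj_mat_sum:
  fixes M :: "'a :: semiring_0 mat"
  assumes "Q \<in> carrier_mat d d" "M \<in> carrier_mat d d" "P \<in> carrier_mat d d" "r < d" "s < d"
  shows "(Q * M * P) $$ (r, s) = (\<Sum>l<d. \<Sum>k<d. Q $$ (r, k) * M $$ (k, l) * P $$ (l, s))"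
proof -
  have "(Q * M * P) $$ (r, s) = (\<Sum>l<d. (Q * M) $$ (r, l) * P $$ (l, s))"
    by (rule index_mult_mat_sum) (use assms in auto)
  also have "\<dots> = (\<Sum>l<d. (\<Sum>k<d. Q $$ (r, k) * M $$ (k, l)) * P $$ (l, s))"
    using assms by (intro sum.cong refl) (simp add: index_mult_mat_sum[of _ d d _ d] del: index_mult_mat)
  finally show ?thesis by (simp add: sum_distrib_right)
qed

lemma component_le_euclid_norm:
  assumes "v \<in> carrier_vec d" "i < d"
  shows "\<bar>v $ i\<bar> \<le> euclid_norm v"
proof -
  have "(v $ i)\<^sup>2 \<le> (\<Sum>l<d. (v $ l)\<^sup>2)"
    using assms(2) by (intro member_le_sum) auto
  also have "\<dots> = v \<bullet> v"
    using assms(1) by (simp add: scalar_prod_def power2_eq_square atLeast0LessThan)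
  finally show ?thesis
    unfolding euclid_norm_def by (intro real_le_rsqrt) simp
qed

text \<open>Since \<open>0\<close> is not an eigenvalue, \<open>A\<close> is invertible and
  \<open>mat_inverse A\<close> is a genuine \<open>Some\<close>. Writing the linear term as
  \<open>A *\<^sub>v y\<close> keeps the inverse out of later arguments.\<close>

lemma quad_minimizer_mult:
  assumes A: "A \<in> sym_mats d {0<..}" and y: "y \<in> carrier_vec d"
  shows "quad_minimizer A (A *\<^sub>v y) = - y"
proof -
  have Ac: "A \<in> carrier_mat d d" and "\<not> eigenvalue A 0"
    using A by (auto simp: sym_mats_def)
  moreover have "0 \<cdot>\<^sub>v v = 0\<^sub>v d" if "v \<in> carrier_vec d" for v :: "real vec"
    using that by (intro eq_vecI) auto
  ultimately have "det A \<noteq> 0"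
    using det_0_iff_vec_prod_zero_field[OF Ac] by (force simp: eigenvalue_def eigenvector_def)
  then have U: "A \<in> Units (ring_mat TYPE(real) d ())"
    by (rule det_non_zero_imp_unit[OF Ac])
  obtain B where B: "mat_inverse A = Some B"
    using mat_inverse(1)[OF Ac, of "()"] U by (cases "mat_inverse A") auto
  from mat_inverse(2)[OF Ac B] have B': "B * A = 1\<^sub>m d" "B \<in> carrier_mat d d" by auto
  have "B *\<^sub>v (A *\<^sub>v y) = y"
    using assoc_mult_mat_vec[OF B'(2) Ac y] B'(1) y by simp
  then show ?thesis by (simp add: quad_minimizer_def B)
qed

text \<open>Similar matrices share their characteristic polynomial, and that of a triangular matrix
  is the product of the linear factors given by its diagonal.\<close>

lemma eigenvalue_conj_upper_triangular:
  fixes M :: "real mat"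
  assumes P: "P \<in> carrier_mat d d" and Q: "Q \<in> carrier_mat d d" and M: "M \<in> carrier_mat d d"
    and inv: "P * Q = 1\<^sub>m d" "Q * P = 1\<^sub>m d" and U: "upper_triangular (Q * M * P)"
  shows "eigenvalue M s \<longleftrightarrow> (\<exists>i<d. s = (Q * M * P) $$ (i, i))"
proof -
  have c: "Q * M * P \<in> carrier_mat d d" using P Q M by auto
  have "similar_mat (Q * M * P) M"
    unfolding similar_mat_def similar_mat_wit_def Let_def using P Q M inv
    by (intro exI[of _ Q] exI[of _ P]) auto
  then have "char_poly M = (\<Prod>a \<leftarrow> diag_mat (Q * M * P). [:- a, 1:])"
    using char_poly_similar char_poly_upper_triangular[OF c U] by metis
  then have "eigenvalue M s \<longleftrightarrow> s \<in> set (diag_mat (Q * M * P))"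
    unfolding eigenvalue_root_char_poly[OF M] by (auto simp: poly_prod_list prod_list_zero_iff)
  also have "\<dots> \<longleftrightarrow> (\<exists>i<d. s = (Q * M * P) $$ (i, i))"
    using P Q M by (auto simp: diag_mat_def)
  finally show ?thesis .
qed

section \<open>The hard matrix and its diagonal scalings\<close>

text \<open>For \<open>d \<ge> 2\<close> this is the diagonal matrix with entries \<open>L\<close>,
  \<open>\<mu>\<close>, ..., \<open>\<mu>\<close>, rotated by 45 degrees in the first two
  coordinates. Unrotated, a diagonal scaling could turn it into the identity.\<close>

definition corner_mat :: "nat \<Rightarrow> real \<Rightarrow> real \<Rightarrow> real mat" where
  "corner_mat d \<mu> L = mat d d (\<lambda>(i, j).
     if i = j then (if i < 2 then (L + \<mu>) / 2 else \<mu>)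
     else if i < 2 \<and> j < 2 then (L - \<mu>) / 2 else 0)"

lemma corner_mat_carrier [simp]: "corner_mat d \<mu> L \<in> carrier_mat d d"
  by (simp add: corner_mat_def)

lemma corner_mat_mult_vec:
  assumes d: "2 \<le> d" and v: "v \<in> carrier_vec d"
  shows "(corner_mat d \<mu> L *\<^sub>v v) $ 0 = (L + \<mu>) / 2 * v $ 0 + (L - \<mu>) / 2 * v $ 1"
    and "(corner_mat d \<mu> L *\<^sub>v v) $ 1 = (L - \<mu>) / 2 * v $ 0 + (L + \<mu>) / 2 * v $ 1"
    and "2 \<le> i \<Longrightarrow> i < d \<Longrightarrow> (corner_mat d \<mu> L *\<^sub>v v) $ i = \<mu> * v $ i"
proof -
  have entry: "corner_mat d \<mu> L $$ (i, l) =
     (if i = l then (if i < 2 then (L + \<mu>) / 2 else \<mu>)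
     else if i < 2 \<and> l < 2 then (L - \<mu>) / 2 else 0)" if "i < d" "l < d" for i l
    using that by (simp add: corner_mat_def)
  have *: "(corner_mat d \<mu> L *\<^sub>v v) $ i = (\<Sum>l<2. corner_mat d \<mu> L $$ (i, l) * v $ l)"
    if "i < 2" for i
  proof -
    have "(corner_mat d \<mu> L *\<^sub>v v) $ i = (\<Sum>l<d. corner_mat d \<mu> L $$ (i, l) * v $ l)"
      by (rule index_mult_mat_vec_sum[OF corner_mat_carrier v]) (use that d in simp)
    also have "\<dots> = (\<Sum>l<2. corner_mat d \<mu> L $$ (i, l) * v $ l)"
      by (rule sum.mono_neutral_right) (use that d in \<open>auto simp: entry\<close>)
    finally show ?thesis .
  qed
  have two: "{..<2::nat} = {0, 1}" by auto
  show "(corner_mat d \<mu> L *\<^sub>v v) $ 0 = (L + \<mu>) / 2 * v $ 0 + (L - \<mu>) / 2 * v $ 1"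
    using *[of 0] d by (simp add: two entry)
  show "(corner_mat d \<mu> L *\<^sub>v v) $ 1 = (L - \<mu>) / 2 * v $ 0 + (L + \<mu>) / 2 * v $ 1"
    using *[of 1] d by (simp add: two entry)
  show "(corner_mat d \<mu> L *\<^sub>v v) $ i = \<mu> * v $ i" if i: "2 \<le> i" "i < d"
  proof -
    have "(corner_mat d \<mu> L *\<^sub>v v) $ i = (\<Sum>l<d. corner_mat d \<mu> L $$ (i, l) * v $ l)"
      by (rule index_mult_mat_vec_sum[OF corner_mat_carrier v i(2)])
    also have "\<dots> = (\<Sum>l\<in>{i}. corner_mat d \<mu> L $$ (i, l) * v $ l)"
      by (rule sum.mono_neutral_right) (use i in \<open>auto simp: entry\<close>)
    finally show ?thesis using i by (simp add: entry)
  qed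
qed

text \<open>Adding and subtracting the first two eigenvalue equations decouples them, with factors
  \<open>L\<close> and \<open>\<mu>\<close>; every other coordinate carries the factor
  \<open>\<mu>\<close>. Some coordinate of an eigenvector is nonzero.\<close>

lemma corner_mat_sym_mats:
  assumes d: "2 \<le> d" and \<mu>: "\<mu> \<le> L"
  shows "corner_mat d \<mu> L \<in> sym_mats d {\<mu>..L}"
proof -
  have "transpose_mat (corner_mat d \<mu> L) = corner_mat d \<mu> L"
    by (rule eq_matI) (auto simp: corner_mat_def)
  moreover have "l \<in> {\<mu>..L}" if "eigenvalue (corner_mat d \<mu> L) l" for l
  proof -
    from that obtain v where v: "v \<in> carrier_vec d" "v \<noteq> 0\<^sub>v d"
      and eq: "corner_mat d \<mu> L *\<^sub>v v = l \<cdot>\<^sub>v v"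
      by (auto simp: eigenvalue_def eigenvector_def corner_mat_def)
    from eq have eqi: "(corner_mat d \<mu> L *\<^sub>v v) $ i = l * v $ i" if "i < d" for i
      using that v(1) by simp
    note e = corner_mat_mult_vec[where \<mu> = \<mu> and L = L, OF d v(1)]
    have e0: "(L + \<mu>) / 2 * v $ 0 + (L - \<mu>) / 2 * v $ 1 = l * v $ 0"
      and e1: "(L - \<mu>) / 2 * v $ 0 + (L + \<mu>) / 2 * v $ 1 = l * v $ 1"
      using eqi[of 0] eqi[of 1] e(1,2) d by simp_all
    have p: "L * (v $ 0 + v $ 1) = l * (v $ 0 + v $ 1)" and m: "\<mu> * (v $ 0 - v $ 1) = l * (v $ 0 - v $ 1)"
      using e0 e1 by (simp_all add: field_simps)
    obtain i where i: "i < d" "v $ i \<noteq> 0"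
      using v by (metis eq_vecI carrier_vecD index_zero_vec)
    show ?thesis
    proof (cases "2 \<le> i")
      case True
      then have "l = \<mu>" using eqi[OF i(1)] e(3)[OF True i(1)] i(2) by simp
      then show ?thesis using \<mu> by simp
    next
      case False
      then have "i = 0 \<or> i = 1" by auto
      then have "v $ 0 + v $ 1 \<noteq> 0 \<or> v $ 0 - v $ 1 \<noteq> 0" using i(2) by auto
      then have "l = L \<or> l = \<mu>" using p m by auto
      then show ?thesis using \<mu> by auto
    qed
  qed
  ultimately show ?thesis by (simp add: sym_mats_def)
qed

text \<open>Vectors supported on the first two coordinates form an invariant subspace, so a 2-by-2
  eigenvalue problem suffices.\<close>

lemma eigenvalue_diagonal_mult_corner_mat:
  assumes d: "2 \<le> d" and D: "D \<in> carrier_mat d d" "diagonal_mat D"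
    and xy: "(x, y) \<noteq> (0, 0)"
    and "D $$ (0, 0) * ((L + \<mu>) / 2 * x + (L - \<mu>) / 2 * y) = s * x"
    and "D $$ (1, 1) * ((L - \<mu>) / 2 * x + (L + \<mu>) / 2 * y) = s * y"
  shows "eigenvalue (D * corner_mat d \<mu> L) s"
proof -
  define v where "v = vec d (\<lambda>i. if i = 0 then x else if i = 1 then y else 0)"
  have v: "v \<in> carrier_vec d" and vi: "v $ 0 = x" "v $ 1 = y" "\<And>i. 2 \<le> i \<Longrightarrow> i < d \<Longrightarrow> v $ i = 0"
    using d by (auto simp: v_def)
  let ?A = "corner_mat d \<mu> L"
  have "(D *\<^sub>v (?A *\<^sub>v v)) $ i = D $$ (i, i) * (?A *\<^sub>v v) $ i" if i: "i < d" for i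
  proof -
    have "(D *\<^sub>v (?A *\<^sub>v v)) $ i = (\<Sum>l<d. D $$ (i, l) * (?A *\<^sub>v v) $ l)"
      by (rule index_mult_mat_vec_sum[OF D(1) _ i]) (simp add: mult_mat_vec_carrier[OF corner_mat_carrier v])
    also have "\<dots> = (\<Sum>l\<in>{i}. D $$ (i, l) * (?A *\<^sub>v v) $ l)"
      by (rule sum.mono_neutral_right) (use i D in \<open>auto simp: diagonal_mat_def\<close>)
    finally show ?thesis by simp
  qed
  moreover have "D $$ (i, i) * (?A *\<^sub>v v) $ i = s * v $ i" if "i < d" for i
  proof -
    consider "i = 0" | "i = 1" | "2 \<le> i" by linarith
    then show ?thesis
      using assms(5,6) corner_mat_mult_vec[where \<mu> = \<mu> and L = L, OF d v] vi that by cases simp_all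
  qed
  ultimately have "D *\<^sub>v (?A *\<^sub>v v) = s \<cdot>\<^sub>v v"
    using D v by (intro eq_vecI) auto
  then have "(D * ?A) *\<^sub>v v = s \<cdot>\<^sub>v v"
    using assoc_mult_mat_vec[OF D(1) corner_mat_carrier v] by simp
  moreover have "v \<noteq> 0\<^sub>v d" using xy vi(1,2) d by auto
  ultimately show ?thesis
    unfolding eigenvalue_def eigenvector_def using v D by (intro exI[of _ v]) simp
qed

text \<open>The 2-by-2 block has trace \<open>a * (\<alpha> + \<beta>)\<close> and determinant
  \<open>\<alpha> * \<beta> * (L * \<mu>)\<close>. The inequality
  \<open>4 * (\<alpha> * \<beta>) \<le> (\<alpha> + \<beta>)\<^sup>2\<close> then bounds
  \<open>s * s'\<close> by a multiple of \<open>(s + s')\<^sup>2\<close>, and the difference factors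
  so as to show the ratio.\<close>

lemma diagonal_scaling_eigenvalue_ratio:
  assumes d: "2 \<le> d" and \<mu>: "0 < \<mu>" "\<mu> < L" and D: "D \<in> carrier_mat d d" "diagonal_mat D"
    and pos: "\<And>s. eigenvalue (D * corner_mat d \<mu> L) s \<Longrightarrow> 0 < s"
  obtains s s' where "eigenvalue (D * corner_mat d \<mu> L) s" "eigenvalue (D * corner_mat d \<mu> L) s'"
    "L / \<mu> * s' \<le> s"
proof -
  define \<alpha> \<beta> where "\<alpha> = D $$ (0, 0)" "\<beta> = D $$ (1, 1)"
  define a h where "a = (L + \<mu>) / 2" "h = (L - \<mu>) / 2"
  note ev = eigenvalue_diagonal_mult_corner_mat[OF d D, of _ _ L \<mu>, folded \<alpha>_\<beta>_def a_h_def]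
  have h: "h \<noteq> 0" and ah: "a\<^sup>2 - h\<^sup>2 = L * \<mu>" and a2: "4 * a\<^sup>2 = (L + \<mu>)\<^sup>2"
    using \<mu> by (simp_all add: a_h_def power2_eq_square field_simps)
  \<comment> \<open>Otherwise \<open>(a, - h)\<close> would give an eigenvector for
    \<open>0\<close>, against \<open>pos\<close>.\<close>
  have \<alpha>: "\<alpha> \<noteq> 0"
  proof
    assume "\<alpha> = 0"
    then have "eigenvalue (D * corner_mat d \<mu> L) 0" by (intro ev[of a "- h"]) (use h in auto)
    from pos[OF this] show False by simp
  qed
  define t where "t = a * (\<alpha> + \<beta>)"
  define q where "q = \<alpha> * \<beta> * (L * \<mu>)"
  \<comment> \<open>The vector \<open>(\<alpha> * h, s - \<alpha> * a)\<close> satisfies the first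
    row identically; the second row is the characteristic equation.\<close>
  have root: "eigenvalue (D * corner_mat d \<mu> L) s" if "s\<^sup>2 - t * s + q = 0" for s
  proof (rule ev[of "\<alpha> * h" "s - \<alpha> * a"])
    have "q = \<alpha> * \<beta> * (a\<^sup>2 - h\<^sup>2)" by (simp add: q_def ah)
    with that show "\<beta> * (h * (\<alpha> * h) + a * (s - \<alpha> * a)) = s * (s - \<alpha> * a)"
      by (simp add: t_def power2_eq_square algebra_simps)
  qed (use \<alpha> h in \<open>auto simp: algebra_simps\<close>)
  have disc: "0 \<le> t\<^sup>2 - 4 * q"
  proof -
    have "t\<^sup>2 - 4 * q = a\<^sup>2 * (\<alpha> - \<beta>)\<^sup>2 + 4 * (\<alpha> * \<beta>) * (a\<^sup>2 - L * \<mu>)"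
      by (simp add: t_def q_def power2_eq_square algebra_simps)
    also have "a\<^sup>2 - L * \<mu> = h\<^sup>2" using ah by simp
    \<comment> \<open>The sign of \<open>\<alpha> * \<beta>\<close> is still open, so the
      discriminant is regrouped into squares with nonnegative weights.\<close>
    also have "a\<^sup>2 * (\<alpha> - \<beta>)\<^sup>2 + 4 * (\<alpha> * \<beta>) * h\<^sup>2 = (a\<^sup>2 - h\<^sup>2) * (\<alpha> - \<beta>)\<^sup>2 + h\<^sup>2 * (\<alpha> + \<beta>)\<^sup>2"
      by (simp add: power2_eq_square algebra_simps)
    also have "\<dots> \<ge> 0" unfolding ah using \<mu> by simp
    finally show ?thesis .
  qed
  define w where "w = sqrt (t\<^sup>2 - 4 * q)"
  have w: "0 \<le> w" "w\<^sup>2 = t\<^sup>2 - 4 * q" using disc by (simp_all add: w_def)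
  define s s' where "s = (t + w) / 2" "s' = (t - w) / 2"
  have sum: "s + s' = t" and prod: "s * s' = q" and le: "s' \<le> s"
    using w by (simp_all add: s_s'_def power2_eq_square field_simps)
  have "eigenvalue (D * corner_mat d \<mu> L) s"
    by (rule root) (simp add: sum[symmetric] prod[symmetric] power2_eq_square algebra_simps)
  moreover have "eigenvalue (D * corner_mat d \<mu> L) s'"
    by (rule root) (simp add: sum[symmetric] prod[symmetric] power2_eq_square algebra_simps)
  ultimately have s: "eigenvalue (D * corner_mat d \<mu> L) s" "0 < s"
      "eigenvalue (D * corner_mat d \<mu> L) s'" "0 < s'"
    using pos by auto
  have "(L + \<mu>)\<^sup>2 * q = 4 * (\<alpha> * \<beta>) * (a\<^sup>2 * (L * \<mu>))"
    by (simp add: q_def flip: a2)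
  also have "\<dots> \<le> (\<alpha> + \<beta>)\<^sup>2 * (a\<^sup>2 * (L * \<mu>))"
  proof (rule mult_right_mono)
    have "0 \<le> (\<alpha> - \<beta>)\<^sup>2" by simp
    then show "4 * (\<alpha> * \<beta>) \<le> (\<alpha> + \<beta>)\<^sup>2" by (simp add: power2_eq_square algebra_simps)
  qed (use \<mu> in simp)
  also have "\<dots> = t\<^sup>2 * (L * \<mu>)" by (simp add: t_def power_mult_distrib mult_ac)
  finally have "0 \<le> (s + s')\<^sup>2 * (L * \<mu>) - (L + \<mu>)\<^sup>2 * (s * s')"
    by (simp add: sum prod)
  also have "\<dots> = (s * \<mu> - s' * L) * (s * L - s' * \<mu>)"
    by (simp add: power2_eq_square algebra_simps)
  finally have "0 \<le> (s * \<mu> - s' * L) * (s * L - s' * \<mu>)" .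
  \<comment> \<open>The second factor is positive, so the first one inherits the sign of the
    product.\<close>
  moreover have "s' * \<mu> < s * L" using le s \<mu> by (intro mult_le_less_imp_less) auto
  ultimately have "0 \<le> s * \<mu> - s' * L" by (simp add: zero_le_mult_iff)
  then have "L / \<mu> * s' \<le> s" using \<mu> by (simp add: field_simps)
  with s show ?thesis by (intro that)
qed

section \<open>Convergence rate of consistent algorithms\<close>

abbreviation mean_coeff :: "nat \<Rightarrow> algorithm \<Rightarrow> real mat \<Rightarrow> nat \<Rightarrow> real mat" where
  "mean_coeff d \<A> A j \<equiv> expectation_mat d (\<A> A) (\<lambda>s. fst s j)"

abbreviation mean_inversion :: "nat \<Rightarrow> algorithm \<Rightarrow> real mat \<Rightarrow> real mat" where
  "mean_inversion d \<A> A \<equiv> expectation_mat d (\<A> A) snd"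

lemma expectation_mat_carrier [simp]: "expectation_mat d M Y \<in> carrier_mat d d"
  by (simp add: expectation_mat_def)

lemma mean_iterate_carrier: "mean_iterate p d \<A> A b X0 k \<in> carrier_vec d"
  by (simp add: mean_iterate_def expectation_vec_def)

lemma sym_mats_mono: "\<Sigma> \<subseteq> \<Sigma>' \<Longrightarrow> sym_mats d \<Sigma> \<subseteq> sym_mats d \<Sigma>'"
  by (auto simp: sym_mats_def)

context
  fixes p d :: nat and \<A> :: algorithm and A :: "real mat"
  assumes scli: "scli p d \<A>" and A: "A \<in> sym_mats d {0<..}"
begin

lemma A_carrier: "A \<in> carrier_mat d d"
  using A by (simp add: sym_mats_def)

lemma law:
  "prob_space (\<A> A)" "sets (\<A> A) = sets (draw_space p d)"
  "j < p \<Longrightarrow> integrable_mat d (\<A> A) (\<lambda>s. fst s j)" "integrable_mat d (\<A> A) snd"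
  using scli A A_carrier by (auto simp: scli_def)

lemma mean_iterate_init:
  assumes "X0 \<in> init_points p d" "k < p"
  shows "mean_iterate p d \<A> A b X0 k = X0 k"
proof -
  interpret prob_space "\<Pi>\<^sub>M n\<in>(UNIV :: nat set). \<A> A"
    by (rule prob_space_PiM[OF law(1)])
  have "iterate p d b X0 \<omega> k = X0 k" for \<omega> using assms(2) by (simp add: iterate.simps)
  moreover have "X0 k \<in> carrier_vec d" using assms by (auto simp: init_points_def)
  ultimately show ?thesis
    by (intro eq_vecI) (simp_all add: mean_iterate_def expectation_vec_def prob_space)
qed

lemma mean_iterate_step:
  assumes X0: "X0 \<in> init_points p d" and b: "b \<in> carrier_vec d" and i: "i < d" and k: "p \<le> k"
  shows "mean_iterate p d \<A> A b X0 k $ i =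
    (\<Sum>j<p. (mean_coeff d \<A> A j *\<^sub>v mean_iterate p d \<A> A b X0 (k - p + j)) $ i)
    + (mean_inversion d \<A> A *\<^sub>v b) $ i"
proof -
  have m: "mean_iterate p d \<A> A b X0 k $ i = (\<integral>\<omega>. iterate p d b X0 \<omega> k $ i \<partial>(\<Pi>\<^sub>M n\<in>UNIV. \<A> A))"
    if "i < d" for k i
    using that by (simp add: mean_iterate_def expectation_vec_def)
  have "mean_iterate p d \<A> A b X0 k $ i = (\<Sum>j<p. \<Sum>l<d. mean_coeff d \<A> A j $$ (i, l) *
            (\<integral>\<omega>. iterate p d b X0 \<omega> (k - p + j) $ l \<partial>(\<Pi>\<^sub>M n\<in>UNIV. \<A> A)))
        + (\<Sum>l<d. mean_inversion d \<A> A $$ (i, l) * b $ l)"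
    unfolding m[OF i] by (rule expectation_iterate) (use law X0 b i k in auto)
  also have "\<dots> = (\<Sum>j<p. \<Sum>l<d. mean_coeff d \<A> A j $$ (i, l) *
            mean_iterate p d \<A> A b X0 (k - p + j) $ l)
        + (\<Sum>l<d. mean_inversion d \<A> A $$ (i, l) * b $ l)"
    by (simp add: m)
  finally show ?thesis
    unfolding index_mult_mat_vec_sum[OF expectation_mat_carrier mean_iterate_carrier i]
      index_mult_mat_vec_sum[OF expectation_mat_carrier b i] .
qed

text \<open>Consistency makes the minimizer a fixed point of the mean recursion for every \<open>b\<close>.\<close>

lemma consistent_inversion_mult:
  assumes cons: "consistent_wrt p d \<A> A" and i: "i < d" and l: "l < d"
  shows "(- mean_inversion d \<A> A * A) $$ (i, l) =
    1\<^sub>m d $$ (i, l) - (\<Sum>j<p. mean_coeff d \<A> A j $$ (i, l))"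
proof -
  \<comment> \<open>With \<open>b\<close> chosen so that the minimizer is the \<open>l\<close>-th
    unit vector, the limit of the recursion reads off column \<open>l\<close>.\<close>
  define y :: "real vec" where "y = unit_vec d l"
  have y: "y \<in> carrier_vec d" by (simp add: y_def)
  define b where "b = A *\<^sub>v (- y)"
  have b: "b \<in> carrier_vec d" unfolding b_def
    by (rule mult_mat_vec_carrier[OF A_carrier]) (use y in simp)
  define X0 :: "nat \<Rightarrow> real vec" where "X0 = (\<lambda>_. 0\<^sub>v d)"
  have X0: "X0 \<in> init_points p d" by (simp add: X0_def init_points_def)
  define m where "m = mean_iterate p d \<A> A b X0"
  have qm: "quad_minimizer A b = y"
    unfolding b_def using quad_minimizer_mult[OF A, of "- y"] y by simp
  have lim: "(\<lambda>k. m k $ r) \<longlonglongrightarrow> y $ r" if "r < d" for r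
  proof (rule LIM_zero_cancel, rule Lim_null_comparison)
    show "(\<lambda>k. euclid_norm (m k - y)) \<longlonglongrightarrow> 0"
      using cons b X0 unfolding consistent_wrt_def m_def qm[symmetric] by blast
    show "\<forall>\<^sub>F k in sequentially. norm (m k $ r - y $ r) \<le> euclid_norm (m k - y)"
    proof (rule always_eventually, rule allI)
      fix k
      have "m k - y \<in> carrier_vec d" using y by (simp add: m_def mean_iterate_carrier)
      from component_le_euclid_norm[OF this that]
      show "norm (m k $ r - y $ r) \<le> euclid_norm (m k - y)" using that y by simp
    qed
  qed
  have mv: "(M *\<^sub>v y) $ i = M $$ (i, l)" if "M \<in> carrier_mat d d" for M :: "real mat"
    using that i l by (simp add: y_def)
  have step: "m (n + p) $ i = (\<Sum>j<p. \<Sum>r<d. mean_coeff d \<A> A j $$ (i, r) * m (n + j) $ r)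
      + (mean_inversion d \<A> A *\<^sub>v b) $ i" for n
    unfolding m_def mean_iterate_step[OF X0 b i le_add2]
      index_mult_mat_vec_sum[OF expectation_mat_carrier mean_iterate_carrier i] by simp
  have "(\<lambda>n. m (n + p) $ i) \<longlonglongrightarrow>
      (\<Sum>j<p. \<Sum>r<d. mean_coeff d \<A> A j $$ (i, r) * y $ r) + (mean_inversion d \<A> A *\<^sub>v b) $ i"
    unfolding step by (intro tendsto_intros LIMSEQ_ignore_initial_segment lim) simp
  moreover have "(\<lambda>n. m (n + p) $ i) \<longlonglongrightarrow> y $ i"
    by (rule LIMSEQ_ignore_initial_segment[OF lim[OF i]])
  ultimately have "y $ i =
      (\<Sum>j<p. \<Sum>r<d. mean_coeff d \<A> A j $$ (i, r) * y $ r) + (mean_inversion d \<A> A *\<^sub>v b) $ i"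
    by (rule LIMSEQ_unique[rotated])
  moreover have "(\<Sum>r<d. mean_coeff d \<A> A j $$ (i, r) * y $ r) = mean_coeff d \<A> A j $$ (i, l)" for j
    unfolding mv[OF expectation_mat_carrier, symmetric]
    by (rule index_mult_mat_vec_sum[symmetric]) (use y i in auto)
  moreover have "(mean_inversion d \<A> A *\<^sub>v b) $ i = (- mean_inversion d \<A> A * A) $$ (i, l)"
  proof -
    have "(- mean_inversion d \<A> A * A) $$ (i, l) = ((- mean_inversion d \<A> A * A) *\<^sub>v y) $ i"
      by (intro mv[symmetric] mult_carrier_mat[OF _ A_carrier]) simp
    also have "(- mean_inversion d \<A> A * A) *\<^sub>v y = - mean_inversion d \<A> A *\<^sub>v (A *\<^sub>v y)"
      by (rule assoc_mult_mat_vec[OF _ A_carrier y, of _ d]) simp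
    also have "\<dots> $ i = (mean_inversion d \<A> A *\<^sub>v b) $ i"
    proof -
      define u where "u = A *\<^sub>v y"
      have u: "u \<in> carrier_vec d" unfolding u_def by (rule mult_mat_vec_carrier[OF A_carrier y])
      have "b = - u"
        unfolding b_def u_def using A_carrier y by (intro eq_vecI) auto
      moreover have "(- E *\<^sub>v u) $ i = (E *\<^sub>v - u) $ i" if "E \<in> carrier_mat d d" for E :: "real mat"
        using that u i by (simp add: scalar_prod_def sum_negf)
      ultimately show ?thesis by (simp add: u_def)
    qed
    finally show ?thesis by simp
  qed
  ultimately show ?thesis using i l by (simp add: y_def)
qed

section \<open>Error components in the triangularizing basis\<close>

text \<open>By triangularity, component \<open>r\<close> is driven only by components with index at
  least \<open>r\<close>. Started on column \<open>i\<close> of \<open>P\<close>, those beyond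
  \<open>i\<close> stay zero, and component \<open>i\<close> follows the scalar recurrence with root
  \<open>z\<close>.\<close>

lemma mean_iterate_triangular_component:
  assumes PQ: "P \<in> carrier_mat d d" "Q \<in> carrier_mat d d" "P * Q = 1\<^sub>m d" "Q * P = 1\<^sub>m d"
    and T: "\<And>j. j < p \<Longrightarrow> upper_triangular (Q * mean_coeff d \<A> A j * P)"
    and i: "i < d" and z: "z \<in> rec_roots p (\<lambda>j. (Q * mean_coeff d \<A> A j * P) $$ (i, i))"
    and r: "i \<le> r" "r < d"
  shows "(Q *\<^sub>v mean_iterate p d \<A> A (0\<^sub>v d) (\<lambda>j. Re (z ^ j) \<cdot>\<^sub>v col P i) k) $ r =
    (if r = i then Re (z ^ k) else 0)"
  using r
proof (induction k arbitrary: r rule: less_induct)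
  case (less k)
  define X0 where "X0 = (\<lambda>j. Re (z ^ j) \<cdot>\<^sub>v col P i)"
  have X0: "X0 \<in> init_points p d" using PQ(1) i by (auto simp: X0_def init_points_def)
  define m where "m = mean_iterate p d \<A> A (0\<^sub>v d) X0"
  have m: "m k \<in> carrier_vec d" for k by (simp add: m_def mean_iterate_carrier)
  show ?case
  proof (cases "k < p")
    case True
    then have "m k = Re (z ^ k) \<cdot>\<^sub>v col P i"
      unfolding m_def mean_iterate_init[OF X0 True] by (simp add: X0_def)
    moreover have "(Q *\<^sub>v col P i) $ r = (Q * P) $$ (r, i)"
      using PQ(1,2) i less.prems by simp
    ultimately have "(Q *\<^sub>v m k) $ r = Re (z ^ k) * (Q * P) $$ (r, i)"
      using PQ(1,2) i less.prems by simp
    then show ?thesis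
      using less.prems i by (simp add: PQ(4) flip: X0_def m_def)
  next
    case False
    let ?C = "mean_coeff d \<A> A" and ?T = "\<lambda>j. Q * mean_coeff d \<A> A j * P"
    have Tc: "?T j \<in> carrier_mat d d" for j using PQ by auto
    have Qm: "Q *\<^sub>v m k \<in> carrier_vec d" for k using PQ m by auto
    have conj: "?T j *\<^sub>v (Q *\<^sub>v m k) = Q *\<^sub>v (?C j *\<^sub>v m k)" for j k
    proof -
      have "?T j *\<^sub>v (Q *\<^sub>v m k) = (Q * ?C j) *\<^sub>v (P *\<^sub>v (Q *\<^sub>v m k))"
        by (rule assoc_mult_mat_vec[OF mult_carrier_mat[OF PQ(2)] PQ(1) Qm]) simp
      also have "P *\<^sub>v (Q *\<^sub>v m k) = m k"
        using assoc_mult_mat_vec[OF PQ(1,2) m, of k] PQ(3) m by simp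
      also have "(Q * ?C j) *\<^sub>v m k = Q *\<^sub>v (?C j *\<^sub>v m k)"
        by (rule assoc_mult_mat_vec[OF PQ(2) expectation_mat_carrier m])
      finally show ?thesis .
    qed
    have Cm: "?C j *\<^sub>v m k \<in> carrier_vec d" for j k
      by (rule mult_mat_vec_carrier[OF expectation_mat_carrier m])
    have mk: "m k $ a = (\<Sum>j<p. (?C j *\<^sub>v m (k - p + j)) $ a)" if "a < d" for a
      unfolding m_def using mean_iterate_step[OF X0 zero_carrier_vec that, of k] False that
      by (simp add: index_mult_mat_vec_sum[OF expectation_mat_carrier zero_carrier_vec])
    have "(Q *\<^sub>v m k) $ r = (\<Sum>a<d. Q $$ (r, a) * (\<Sum>j<p. (?C j *\<^sub>v m (k - p + j)) $ a))"
      unfolding index_mult_mat_vec_sum[OF PQ(2) m less.prems(2)] by (simp add: mk)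
    also have "\<dots> = (\<Sum>j<p. \<Sum>a<d. Q $$ (r, a) * (?C j *\<^sub>v m (k - p + j)) $ a)"
      unfolding sum_distrib_left by (rule sum.swap)
    also have "\<dots> = (\<Sum>j<p. (?T j *\<^sub>v (Q *\<^sub>v m (k - p + j))) $ r)"
      unfolding conj index_mult_mat_vec_sum[OF PQ(2) Cm less.prems(2)] ..
    also have "\<dots> = (\<Sum>j<p. ?T j $$ (r, r) * (Q *\<^sub>v m (k - p + j)) $ r)"
    proof (rule sum.cong[OF refl])
      fix j assume "j \<in> {..<p}"
      then have j: "j < p" and kj: "k - p + j < k" using False by auto
      have "(?T j *\<^sub>v (Q *\<^sub>v m (k - p + j))) $ r =
          (\<Sum>s<d. ?T j $$ (r, s) * (Q *\<^sub>v m (k - p + j)) $ s)"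
        by (rule index_mult_mat_vec_sum[OF Tc Qm less.prems(2)])
      also have "\<dots> = (\<Sum>s\<in>{r}. ?T j $$ (r, s) * (Q *\<^sub>v m (k - p + j)) $ s)"
      proof (rule sum.mono_neutral_right)
        show "\<forall>s\<in>{..<d} - {r}. ?T j $$ (r, s) * (Q *\<^sub>v m (k - p + j)) $ s = 0"
        proof
          fix s assume s: "s \<in> {..<d} - {r}"
          \<comment> \<open>Below the diagonal the matrix entry vanishes; beyond \<open>r\<close>
            the component vanishes by induction, since \<open>s > r \<ge> i\<close>.\<close>
          consider "s < r" | "r < s" using s by fastforce
          then show "?T j $$ (r, s) * (Q *\<^sub>v m (k - p + j)) $ s = 0"
          proof cases
            case 1
            then have "?T j $$ (r, s) = 0"
              using upper_triangularD[OF T[OF j], of s r] carrier_matD(1)[OF Tc[of j]] less.prems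
              by simp
            then show ?thesis by simp
          next
            case 2
            then have "(Q *\<^sub>v m (k - p + j)) $ s = 0"
              using less.IH[OF kj, of s] less.prems s unfolding m_def X0_def by auto
            then show ?thesis by simp
          qed
        qed
      qed (use less.prems in auto)
      finally show "(?T j *\<^sub>v (Q *\<^sub>v m (k - p + j))) $ r = ?T j $$ (r, r) * (Q *\<^sub>v m (k - p + j)) $ r"
        by simp
    qed
    also have "\<dots> = (\<Sum>j<p. ?T j $$ (r, r) * (if r = i then Re (z ^ (k - p + j)) else 0))"
    proof (rule sum.cong[OF refl])
      fix j assume "j \<in> {..<p}"
      then have "k - p + j < k" using False by auto
      from less.IH[OF this less.prems]
      show "?T j $$ (r, r) * (Q *\<^sub>v m (k - p + j)) $ r =
          ?T j $$ (r, r) * (if r = i then Re (z ^ (k - p + j)) else 0)"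
        unfolding m_def X0_def by simp
    qed
    also have "\<dots> = (if r = i then Re (z ^ k) else 0)"
      using Re_power_recurrence[OF z, of k] False by auto
    finally show ?thesis unfolding m_def X0_def .
  qed
qed

text \<open>Component \<open>i\<close> of the transformed error is \<open>Re (z ^ k)\<close>, which
  row \<open>i\<close> of \<open>Q\<close> bounds by the error norm; steps \<open>k\<close> and
  \<open>Suc k\<close> together control \<open>cmod z ^ k\<close>. The premise has the form supplied
  by \<open>iteration_complexity\<close>.\<close>

lemma root_power_le_error:
  assumes PQ: "P \<in> carrier_mat d d" "Q \<in> carrier_mat d d" "P * Q = 1\<^sub>m d" "Q * P = 1\<^sub>m d"
    and T: "\<And>j. j < p \<Longrightarrow> upper_triangular (Q * mean_coeff d \<A> A j * P)"
    and i: "i < d" and z: "z \<in> rec_roots p (\<lambda>j. (Q * mean_coeff d \<A> A j * P) $$ (i, i))"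
  obtains X0 B where "X0 \<in> init_points p d" "0 < B"
    "\<And>k \<eta>. (\<And>n. k \<le> n \<Longrightarrow>
        euclid_norm (mean_iterate p d \<A> A (0\<^sub>v d) X0 n - quad_minimizer A (0\<^sub>v d)) < \<eta>) \<Longrightarrow>
      cmod z ^ k \<le> B * \<eta>"
proof -
  define X0 where "X0 = (\<lambda>j. Re (z ^ j) \<cdot>\<^sub>v col P i)"
  have X0: "X0 \<in> init_points p d" using PQ(1) i by (auto simp: X0_def init_points_def)
  define m where "m = mean_iterate p d \<A> A (0\<^sub>v d) X0"
  have m: "m k \<in> carrier_vec d" for k by (simp add: m_def mean_iterate_carrier)
  have "A *\<^sub>v 0\<^sub>v d = 0\<^sub>v d" using A_carrier by (intro eq_vecI) auto
  then have "quad_minimizer A (0\<^sub>v d) = 0\<^sub>v d"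
    using quad_minimizer_mult[OF A zero_carrier_vec] by simp
  then have err: "m n - quad_minimizer A (0\<^sub>v d) = m n" for n
    using m[of n] by (intro eq_vecI) auto
  \<comment> \<open>The summand \<open>1\<close> makes \<open>q\<close> strictly positive.\<close>
  define q where "q = (\<Sum>a<d. \<bar>Q $$ (i, a)\<bar>) + 1"
  have q: "0 < q" by (simp add: q_def add_nonneg_pos sum_nonneg)
  have Re_le: "\<bar>Re (z ^ k)\<bar> \<le> q * euclid_norm (m k)" for k
  proof -
    have "Re (z ^ k) = (Q *\<^sub>v m k) $ i"
      using mean_iterate_triangular_component[OF PQ T i z order_refl i, of k]
      by (simp add: m_def X0_def)
    also have "\<dots> = (\<Sum>a<d. Q $$ (i, a) * m k $ a)"
      by (rule index_mult_mat_vec_sum[OF PQ(2) m i])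
    also have "\<bar>\<dots>\<bar> \<le> (\<Sum>a<d. \<bar>Q $$ (i, a)\<bar> * euclid_norm (m k))"
      by (rule order_trans[OF sum_abs])
         (auto simp: abs_mult intro!: sum_mono mult_left_mono component_le_euclid_norm m)
    also have "\<dots> \<le> q * euclid_norm (m k)"
      using component_le_euclid_norm[OF m[of k] i]
      by (auto simp: q_def sum_distrib_right[symmetric] intro!: mult_right_mono)
    finally show ?thesis .
  qed
  obtain B where B: "0 < B"
    "\<And>k \<eta>. \<bar>Re (z ^ k)\<bar> \<le> \<eta> \<Longrightarrow> \<bar>Re (z ^ Suc k)\<bar> \<le> \<eta> \<Longrightarrow> cmod z ^ k \<le> B * \<eta>"
    using norm_power_le_Re_powers[of z] by blast
  show ?thesis
  proof (rule that[OF X0, of "B * q"])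
    show "0 < B * q" using B q by simp
    fix k \<eta>
    assume *: "\<And>n. k \<le> n \<Longrightarrow>
      euclid_norm (mean_iterate p d \<A> A (0\<^sub>v d) X0 n - quad_minimizer A (0\<^sub>v d)) < \<eta>"
    have "\<bar>Re (z ^ n)\<bar> \<le> q * \<eta>" if "k \<le> n" for n
    proof -
      have "euclid_norm (m n) \<le> \<eta>" using *[OF that, folded m_def] unfolding err by simp
      then show ?thesis using Re_le[of n] q by (meson mult_left_mono order_trans less_imp_le)
    qed
    then have "cmod z ^ k \<le> B * (q * \<eta>)" by (intro B(2)) (simp_all del: power_Suc)
    then show "cmod z ^ k \<le> B * q * \<eta>" by (simp add: mult.assoc)
  qed
qed

text \<open>Powers of a root of modulus at least \<open>1\<close> stay at least \<open>1\<close> in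
  modulus, while consistency sends the error that dominates them to zero.\<close>

lemma consistent_roots_less_one:
  assumes cons: "consistent_wrt p d \<A> A"
    and PQ: "P \<in> carrier_mat d d" "Q \<in> carrier_mat d d" "P * Q = 1\<^sub>m d" "Q * P = 1\<^sub>m d"
    and T: "\<And>j. j < p \<Longrightarrow> upper_triangular (Q * mean_coeff d \<A> A j * P)"
    and i: "i < d" and z: "z \<in> rec_roots p (\<lambda>j. (Q * mean_coeff d \<A> A j * P) $$ (i, i))"
  shows "cmod z < 1"
proof (rule ccontr)
  assume z1: "\<not> cmod z < 1"
  obtain X0 B where X0: "X0 \<in> init_points p d" and B: "0 < B"
    "\<And>k \<eta>. (\<And>n. k \<le> n \<Longrightarrow>
        euclid_norm (mean_iterate p d \<A> A (0\<^sub>v d) X0 n - quad_minimizer A (0\<^sub>v d)) < \<eta>) \<Longrightarrow>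
      cmod z ^ k \<le> B * \<eta>"
    using root_power_le_error[OF PQ T i z] by blast
  have "(\<lambda>k. euclid_norm (mean_iterate p d \<A> A (0\<^sub>v d) X0 k - quad_minimizer A (0\<^sub>v d))) \<longlonglongrightarrow> 0"
    using cons X0 by (simp add: consistent_wrt_def)
  \<comment> \<open>The threshold makes \<open>B * \<eta>\<close> equal to \<open>1 / 2\<close>,
    which is below \<open>1\<close>.\<close>
  from order_tendstoD(2)[OF this, of "1 / (2 * B)"] B(1) obtain k where
    "\<And>n. k \<le> n \<Longrightarrow>
        euclid_norm (mean_iterate p d \<A> A (0\<^sub>v d) X0 n - quad_minimizer A (0\<^sub>v d)) < 1 / (2 * B)"
    by (auto simp: eventually_sequentially)
  from B(2)[OF this] have "cmod z ^ k \<le> 1 / 2" using B(1) by simp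
  moreover have "1 \<le> cmod z ^ k" using z1 by (intro one_le_power) simp
  ultimately show False by simp
qed

lemma mean_inversion_diagonal:
  assumes "diagonal_inversion d \<A>"
  shows "diagonal_mat (mean_inversion d \<A> A)"
  unfolding diagonal_mat_def
proof (intro allI impI)
  fix i l assume il: "i < dim_row (mean_inversion d \<A> A)" "l < dim_col (mean_inversion d \<A> A)" "i \<noteq> l"
  then have il': "i < d" "l < d" by (simp_all add: expectation_mat_def)
  have "AE s in \<A> A. diagonal_mat (snd s)"
    using assms A_carrier by (simp add: diagonal_inversion_def)
  \<comment> \<open>\<open>diagonal_mat\<close> refers to the actual dimensions of a draw, which are
    known on the space of the law.\<close>
  with AE_space[of "\<A> A"] have "AE s in \<A> A. snd s $$ (i, l) = 0"
  proof eventually_elim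
    case (elim s)
    from space_draw(2)[OF law(2) elim(1)] elim(2) il il' show ?case
      by (auto simp: diagonal_mat_def)
  qed
  then have "(\<integral>s. snd s $$ (i, l) \<partial>\<A> A) = 0"
    by (rule integral_eq_zero_AE)
  then show "mean_inversion d \<A> A $$ (i, l) = 0"
    using il' by (simp add: expectation_mat_def)
qed

text \<open>The hypothesis \<open>ratio\<close> is conditional on positivity because the eigenvalues are the values at \<open>1\<close> of
monic real polynomials with all roots in the open unit disc, which is known only after triangularizing.\<close>

lemma complexity_lower_bound:
  assumes p: "1 \<le> p" and cons: "consistent_wrt p d \<A> A"
    and \<kappa>: "1 < \<kappa>"
    and ratio: "(\<And>s. eigenvalue (- mean_inversion d \<A> A * A) s \<Longrightarrow> 0 < s) \<Longrightarrow>
      \<exists>s s'. eigenvalue (- mean_inversion d \<A> A * A) s \<and>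
        eigenvalue (- mean_inversion d \<A> A * A) s' \<and> \<kappa> * s' \<le> s"
  shows "\<exists>X0 \<in> init_points p d. Omega_tilde (1 / 2) ((root p \<kappa> - 1) / 2)
    (\<lambda>\<epsilon>. real (iteration_complexity p d \<A> \<epsilon> A (0\<^sub>v d) X0))"
proof -
  let ?C = "mean_coeff d \<A> A"
  have "simultaneously_triangularizable d (?C ` {..<p})"
    using scli A by (auto simp: scli_def)
  then obtain P Q where PQ: "P \<in> carrier_mat d d" "Q \<in> carrier_mat d d" "P * Q = 1\<^sub>m d" "Q * P = 1\<^sub>m d"
    and T: "\<And>j. j < p \<Longrightarrow> upper_triangular (Q * ?C j * P)"
    unfolding simultaneously_triangularizable_def inverts_mat_def by auto
  define t where "t i j = (Q * ?C j * P) $$ (i, i)" for i j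
  define M where "M = - mean_inversion d \<A> A * A"
  have M: "M \<in> carrier_mat d d" unfolding M_def by (rule mult_carrier_mat[OF _ A_carrier]) simp
  \<comment> \<open>The consistency identity conjugated by \<open>P\<close> and \<open>Q\<close>:
    one change of basis triangularizes \<open>M\<close> along with all mean coefficients.\<close>
  have U: "(Q * M * P) $$ (r, s) = 1\<^sub>m d $$ (r, s) - (\<Sum>j<p. (Q * ?C j * P) $$ (r, s))"
    if rs: "r < d" "s < d" for r s
  proof -
    have "(Q * M * P) $$ (r, s) = (\<Sum>l<d. \<Sum>k<d. Q $$ (r, k) * M $$ (k, l) * P $$ (l, s))"
      by (rule index_conj_mat_sum[OF PQ(2) M PQ(1) rs])
    also have "\<dots> = (\<Sum>l<d. \<Sum>k<d. Q $$ (r, k) * 1\<^sub>m d $$ (k, l) * P $$ (l, s)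
        - (\<Sum>j<p. Q $$ (r, k) * ?C j $$ (k, l) * P $$ (l, s)))"
      unfolding M_def
      by (intro sum.cong refl, subst consistent_inversion_mult[OF cons])
         (auto simp: algebra_simps sum_distrib_left sum_distrib_right)
    also have "\<dots> = (\<Sum>l<d. \<Sum>k<d. Q $$ (r, k) * 1\<^sub>m d $$ (k, l) * P $$ (l, s))
        - (\<Sum>l<d. \<Sum>k<d. \<Sum>j<p. Q $$ (r, k) * ?C j $$ (k, l) * P $$ (l, s))"
      by (simp only: sum_subtractf)
    also have "(\<Sum>l<d. \<Sum>k<d. Q $$ (r, k) * 1\<^sub>m d $$ (k, l) * P $$ (l, s)) = (Q * 1\<^sub>m d * P) $$ (r, s)"
      by (rule index_conj_mat_sum[OF PQ(2) one_carrier_mat PQ(1) rs, symmetric])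
    also have "Q * 1\<^sub>m d * P = 1\<^sub>m d" using PQ by simp
    also have "(\<Sum>l<d. \<Sum>k<d. \<Sum>j<p. Q $$ (r, k) * ?C j $$ (k, l) * P $$ (l, s))
        = (\<Sum>j<p. \<Sum>l<d. \<Sum>k<d. Q $$ (r, k) * ?C j $$ (k, l) * P $$ (l, s))"
      by (rule trans[OF sum.cong[OF refl sum.swap] sum.swap])
    also have "\<dots> = (\<Sum>j<p. (Q * ?C j * P) $$ (r, s))"
      by (intro sum.cong refl index_conj_mat_sum[OF PQ(2) expectation_mat_carrier PQ(1) rs, symmetric])
    finally show ?thesis .
  qed
  have "upper_triangular (Q * M * P)"
  proof (rule upper_triangularI)
    fix r s assume "s < r" "r < dim_row (Q * M * P)"
    then have rs: "s < r" "r < d" "s < d" using PQ by auto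
    have "(Q * ?C j * P) $$ (r, s) = 0" if "j < p" for j
      using T[OF that] rs PQ by (auto dest: upper_triangularD)
    then show "(Q * M * P) $$ (r, s) = 0" using U[of r s] rs by simp
  qed
  note ev = eigenvalue_conj_upper_triangular[OF PQ(1,2) M PQ(3,4) this]
  have diag: "(Q * M * P) $$ (i, i) = 1 - (\<Sum>j<p. t i j)" if "i < d" for i
    using U[OF that that] that by (simp add: t_def)
  have roots: "cmod z < 1" if "i < d" "z \<in> rec_roots p (t i)" for i z
    by (rule consistent_roots_less_one[OF cons PQ T that(1)]) (use that(2) in \<open>auto simp: t_def[abs_def]\<close>)
  \<comment> \<open>This discharges the positivity premise of \<open>ratio\<close>.\<close>
  have "0 < s" if "eigenvalue M s" for s
    using that one_minus_sum_pos[of p "t _"] roots diag unfolding ev by auto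
  then obtain s s' where "eigenvalue M s" "eigenvalue M s'" and s: "\<kappa> * s' \<le> s"
    using ratio unfolding M_def by blast
  then obtain i i' where i: "i < d" "i' < d"
    and si: "s = 1 - (\<Sum>j<p. t i j)" "s' = 1 - (\<Sum>j<p. t i' j)"
    unfolding ev using diag by auto
  \<comment> \<open>Only the two recurrences behind \<open>s\<close> and \<open>s'\<close> matter.
    Their largest root modulus \<open>\<rho>\<close> bounds both values at \<open>1\<close>, and
    since it is attained it is also a decay rate of the error.\<close>
  let ?Z = "rec_roots p (t i) \<union> rec_roots p (t i')"
  have Z: "finite ?Z" "?Z \<noteq> {}"
    using finite_rec_roots rec_roots_nonempty[OF p] by auto
  define \<rho> where "\<rho> = Max (cmod ` ?Z)"
  have "\<rho> \<in> cmod ` ?Z" unfolding \<rho>_def by (rule Max_in) (use Z in auto)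
  then obtain z n where z: "\<rho> = cmod z" "n < d" "z \<in> rec_roots p (t n)" using i by auto
  have le: "cmod y \<le> \<rho>" if "y \<in> ?Z" for y
    unfolding \<rho>_def by (rule Max_ge) (use Z that in auto)
  have \<rho>: "0 \<le> \<rho>" "\<rho> < 1" using z roots by auto
  have "s \<le> (1 + \<rho>) ^ p"
    unfolding si by (rule one_minus_sum_bounds(2)[OF _ \<rho>(2)]) (use le in auto)
  moreover have "(1 - \<rho>) ^ p \<le> s'"
    unfolding si by (rule one_minus_sum_bounds(1)[OF _ \<rho>(2)]) (use le in auto)
  ultimately have R: "(root p \<kappa> - 1) / 2 \<le> \<rho> / (1 - \<rho>)"
    using rate_bound[OF p _ \<rho> _ _ s] \<kappa> by simp
  have R0: "0 < (root p \<kappa> - 1) / 2" using \<kappa> p by simp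
  \<comment> \<open>\<open>\<kappa> > 1\<close> rules out termination at rate zero, where
    \<open>ln (1 / \<rho>)\<close> would be meaningless.\<close>
  with R have "\<rho> \<noteq> 0" by auto
  with \<rho> have \<rho>0: "0 < \<rho>" by simp
  obtain X0 B where X0: "X0 \<in> init_points p d" and B: "0 < B"
    "\<And>k \<eta>. (\<And>n. k \<le> n \<Longrightarrow>
        euclid_norm (mean_iterate p d \<A> A (0\<^sub>v d) X0 n - quad_minimizer A (0\<^sub>v d)) < \<eta>) \<Longrightarrow>
      cmod z ^ k \<le> B * \<eta>"
    using root_power_le_error[OF PQ T z(2), of z] z(3) unfolding t_def[abs_def] by blast
  have "\<rho> ^ iteration_complexity p d \<A> \<epsilon> A (0\<^sub>v d) X0 \<le> B * \<epsilon>" if "0 < \<epsilon>" for \<epsilon>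
  proof -
    have "(\<lambda>k. euclid_norm (mean_iterate p d \<A> A (0\<^sub>v d) X0 k - quad_minimizer A (0\<^sub>v d))) \<longlonglongrightarrow> 0"
      using cons X0 by (simp add: consistent_wrt_def)
    \<comment> \<open>Convergence makes the set under \<open>LEAST\<close> nonempty, so the minimum
      has the defining property.\<close>
    from order_tendstoD(2)[OF this that] have "\<exists>K. \<forall>k\<ge>K.
        euclid_norm (mean_iterate p d \<A> A (0\<^sub>v d) X0 k - quad_minimizer A (0\<^sub>v d)) < \<epsilon>"
      by (simp add: eventually_sequentially)
    from LeastI_ex[OF this] show ?thesis
      unfolding z(1) iteration_complexity_def by (intro B(2)) blast
  qed
  with Omega_tilde_geometric[OF \<rho>0 \<rho>(2) B(1) _ R] R0 X0 show ?thesis by (intro bexI[of _ X0]) auto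
qed

end

text \<open>The constant is quantified first and so is universal. The premise for
  \<open>d = 1\<close> excludes the case refuted by
  \<open>one_dimensional_exception\<close>.\<close>

theorem theorem8:
  shows "\<exists>c>0. \<forall>(d::nat) (p::nat) (\<mu>::real) (L::real) (\<A>::algorithm).
     1 \<le> d \<longrightarrow> 1 \<le> p \<longrightarrow> 0 < \<mu> \<longrightarrow> \<mu> \<le> L \<longrightarrow> (d = 1 \<longrightarrow> \<mu> = L) \<longrightarrow>
     scli p d \<A> \<longrightarrow> consistent p d \<A> {\<mu>..L} \<longrightarrow> diagonal_inversion d \<A> \<longrightarrow>
     (\<exists>A \<in> sym_mats d {\<mu>..L}. \<exists>b \<in> carrier_vec d. \<exists>X0 \<in> init_points p d.
        Omega_tilde c ((root p (L / \<mu>) - 1) / 2)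
          (\<lambda>\<epsilon>. real (iteration_complexity p d \<A> \<epsilon> A b X0)))"
proof (rule exI[of _ "1 / 2"], intro conjI allI impI)
  fix d p :: nat and \<mu> L :: real and \<A> :: algorithm
  assume d: "1 \<le> d" and p: "1 \<le> p" and \<mu>: "0 < \<mu>" and L: "\<mu> \<le> L" and d1: "d = 1 \<longrightarrow> \<mu> = L"
    and scli: "scli p d \<A>" and cons: "consistent p d \<A> {\<mu>..L}" and diag: "diagonal_inversion d \<A>"
  show "\<exists>A \<in> sym_mats d {\<mu>..L}. \<exists>b \<in> carrier_vec d. \<exists>X0 \<in> init_points p d.
      Omega_tilde (1 / 2) ((root p (L / \<mu>) - 1) / 2)
        (\<lambda>\<epsilon>. real (iteration_complexity p d \<A> \<epsilon> A b X0))"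
  proof (cases "\<mu> = L")
    \<comment> \<open>Here the factor \<open>(root p (L / \<mu>) - 1) / 2\<close> is zero, so any
      admissible function and initialization serve.\<close>
    case True
    have "\<mu> \<cdot>\<^sub>m 1\<^sub>m d \<in> sym_mats d {\<mu>..L}"
    proof -
      have "l = \<mu>" if ev: "eigenvalue (\<mu> \<cdot>\<^sub>m 1\<^sub>m d) l" for l
      proof -
        from ev obtain v where v: "v \<in> carrier_vec d" "v \<noteq> 0\<^sub>v d" "(\<mu> \<cdot>\<^sub>m 1\<^sub>m d) *\<^sub>v v = l \<cdot>\<^sub>v v"
          by (auto simp: eigenvalue_def eigenvector_def)
        then obtain i where i: "i < d" "v $ i \<noteq> 0" by (metis eq_vecI carrier_vecD index_zero_vec)
        have "((\<mu> \<cdot>\<^sub>m 1\<^sub>m d) *\<^sub>v v) $ i = \<mu> * v $ i" using v(1) i(1) by simp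
        with v i show ?thesis by simp
      qed
      moreover have "transpose_mat (\<mu> \<cdot>\<^sub>m 1\<^sub>m d) = (\<mu> \<cdot>\<^sub>m 1\<^sub>m d :: real mat)"
        by (rule eq_matI) auto
      ultimately show ?thesis using True by (simp add: sym_mats_def)
    qed
    moreover have "(\<lambda>_. 0\<^sub>v d) \<in> init_points p d" by (simp add: init_points_def)
    moreover have "Omega_tilde (1 / 2) ((root p (L / \<mu>) - 1) / 2) (\<lambda>\<epsilon>. real (g \<epsilon>))" for g
      using True \<mu> p by (auto simp: Omega_tilde_def intro!: exI[of _ "1 / 2"])
    ultimately show ?thesis by (meson zero_carrier_vec)
  next
    case False
    with L have \<mu>L: "\<mu> < L" by simp
    have d2: "2 \<le> d" using d d1 False by (cases "d = 1") auto
    let ?A = "corner_mat d \<mu> L"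
    have A: "?A \<in> sym_mats d {\<mu>..L}" by (rule corner_mat_sym_mats[OF d2 L])
    have A': "?A \<in> sym_mats d {0<..}" by (rule subsetD[OF sym_mats_mono A]) (use \<mu> in auto)
    let ?D = "- mean_inversion d \<A> ?A"
    have D: "?D \<in> carrier_mat d d" "diagonal_mat ?D"
      using mean_inversion_diagonal[OF scli A' diag] by (auto simp: diagonal_mat_def)
    have "\<exists>X0 \<in> init_points p d. Omega_tilde (1 / 2) ((root p (L / \<mu>) - 1) / 2)
        (\<lambda>\<epsilon>. real (iteration_complexity p d \<A> \<epsilon> ?A (0\<^sub>v d) X0))"
    proof (rule complexity_lower_bound[OF scli A' p])
      show "consistent_wrt p d \<A> ?A" using cons A by (simp add: consistent_def)
      show "1 < L / \<mu>" using \<mu> \<mu>L by simp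
      assume "\<And>s. eigenvalue (?D * ?A) s \<Longrightarrow> 0 < s"
      from diagonal_scaling_eigenvalue_ratio[OF d2 \<mu> \<mu>L D this]
      show "\<exists>s s'. eigenvalue (?D * ?A) s \<and> eigenvalue (?D * ?A) s' \<and> L / \<mu> * s' \<le> s"
        by metis
    qed
    with A show ?thesis using zero_carrier_vec by blast
  qed
qed simp

end
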